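(* Let $q>0$. Let $P(t)$ be a matrix-valued function with $P(t)=P^\star(t)\in\mathbb{C}^{N\times N}$ (it may depend on the filter state $\hat{\vec\omega}(t)$) such that, for every $(\vec\omega_0,\vec f,\vec\eta)\in\mathcal E$, the filter equation $$\frac{d\hat{\vec\omega}}{dt}=B(\hat{\vec\omega})\hat{\vec\omega}+A\hat{\vec\omega}+PH^\star(\vec y-H\hat{\vec\omega}),\qquad \hat{\vec\omega}(0)=0,$$ driven by the output $\vec y(t)=H\vec\omega(t)+F\vec\eta(t)$ of the state equation $$\frac{d\vec\omega}{dt}=B(\vec\omega)\vec\omega+A\vec\omega+D\vec f,\qquad \vec\omega(0)=\vec\omega_0,$$ has a solution $\hat{\vec\omega}$ on $t\ge 0$, and along this solution, for all $t\ge0$, $$B_1(\hat{\vec\omega})+B_1^\star(\hat{\vec\omega})+DQD^\star-PH^\star H-H^\star HP+PH^\star FRF^\star HP<-qI .$$ Then for all $t\ge 0$ $$\max_{(\vec\omega_0,\vec f,\vec\eta)\in\mathcal E}\sigma(t)\le C_1(q)+C_2(q)\,e^{-(2|\lambda(A)|+q)t},$$ where $\sigma(t)=\bigl(\vec\omega(t)-\hat{\vec\omega}(t),\,\vec\omega(t)-\hat{\vec\omega}(t)\bigr)_{\mathbb{C}^N}$ is the squared estimation error corresponding to $(\vec\omega_0,\vec f,\vec\eta)$, $C_1(q):=\frac{1}{2|\lambda(A)|+q}$, $C_2(q):=\lambda(S)-\frac{1}{2|\lambda(A)|+q}$, and $\lambda(X)$ denotes the maximal eigenvalue of the matrix $X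$.
   Context: Setting: Fourier-Galerkin approximation of the 2D Navier-Stokes vorticity equation on the periodic rectangle $\Omega=(0,L_x)\times(0,L_y)$ with zero mean velocity and diffusion coefficient $\nu>0$. $N_1,N_2$ are even positive integers and $N:=(N_1+1)(N_2+1)$. Vectors in $\mathbb{C}^N$ are indexed by modes $(c,d)\in\mathbb{Z}^2$ with $|c|\le N_1/2$, $|d|\le N_2/2$, ordered lexicographically (so mode $(0,0)$ is in the middle and the $j$-th mode from the start is the negative of the $j$-th mode from the end). $X^\star$ is the conjugate transpose, $(x,y)_{\mathbb{C}^n}=\sum_j x_j\overline{y_j}$, and $X<Y$ for Hermitian matrices means $Y-X$ is positive definite. $L^2(\Omega)$ carries the inner product $(f,g)_{L^2(\Omega)}=\frac{1}{L_xL_y}\int_\Omega f\overline g\,dx\,dy$, and $\phi_{cd}(x,y)=e^{2\pi i cx/L_x}e^{2\pi i dy/L_y}$. Matrices of the model: - $A=-\nu\,\mathrm{diag}(\lambda_{cd})$ over all modes, with $\lambda_{cd}=\frac{4\pi^2c^2}{L_x^2}+\frac{4\pi^2d^2}{L_y^2}$ (so $\lambda_{00}=0$). - For $\vec\omega=\{\omega_{pq}\}\in\mathbb{C}^N$, $B(\vec\omega)$ is the $N\times N$ matrix whose entry in row $(c,d)$, column $(n,m)$ is $$-\sum_{(p,q)\ne(0,0)}\frac{\omega_{pq}(pm-qn)L_xL_y}{p^2L_y^2+q^2L_x^2}\,\delta_{p+n,c}\,\delta_{q+m,d},$$ the sum being over modes $|p|\le N_1/2$, $|q|\le N_2/2$.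 (Here the summation index $q$ is unrelated to the scalar $q>0$ of the claim.) - $D$ is the $N\times N$ matrix of a given bounded linear operator $\mathcal D$ on $L^2(\Omega)$ in the basis $\{\phi_{cd}\}$: $(D\vec f)_{cd}=\sum_{m,n}(\mathcal D\phi_{mn},\phi_{cd})_{L^2(\Omega)}f_{mn}$. - $H$ is the $M\times N$ matrix with entries $(H_k,\phi_{s_1,s_2})_{L^2(\Omega)}$ for given averaging kernels $H_k$, $k=1,\dots,M$; $F$ is a given $M\times M$ matrix. - $\Psi$ is the $N\times N$ matrix $$\Psi=\frac{1}{\sqrt2}\begin{pmatrix} I_n & 0 & J_n \\ 0 & 0 & 0 \\ J_n & 0 & -I_n \end{pmatrix},\qquad n=\frac{N-1}{2},$$ where $I_n$ is the identity, $J_n$ the row-reversed identity, and the middle row and column have size one. - $B_1(\hat{\vec\omega}):=\bigl(B(\Psi e_1)\hat{\vec\omega}\ \cdots\ B(\Psi e_N)\hat{\vec\omega}\bigr)\Psi^\star$, where $e_j$ is the $j$-th canonical basis vector and the bracket is the matrix with the indicated columns. Uncertainty: $Q=Q(t)$, $R=R(t)$, $S$ are given positive definite Hermitian matrices of sizes $N$, $M$, $N$. $\mathcal E$ is the set of triples $(\vec\omega_0,\vec f,\vec\eta)$, with $\vec f,\vec\eta$ measurable functions of $t$, such that $(S^{-1}\vec\omega_0,\vec\omega_0)_{\mathbb{C}^N}\le1$ and $(Q^{-1}(t)\vec f(t),\vec f(t))_{\mathbb{C}^N}+(R^{-1}(t)\vec\eta(t),\vec\eta(t))_{\mathbb{C}^M}\le1$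 for all $t\ge 0$. Standing assumption: the state represents a real-valued, zero-mean vorticity, i.e. the data are such that the solution of the state equation satisfies $\omega_{-c,-d}(t)=\overline{\omega_{cd}(t)}$ for all modes and $\omega_{00}(t)=0$ for all $t\ge0$; the elements of $\mathcal E$ are understood to be of this kind. For each such triple the state equation has a unique solution $\vec\omega$ on $t\ge0$. Solutions of differential equations are absolutely continuous and satisfy the equation for almost every $t$. The maximum over $\mathcal E$ is understood as a supremum. *)

theory Defs
  imports "HOL-Analysis.Analysis"
begin

section \<open>Complex matrices\<close>

type_synonym 'n cvec = "complex ^ 'n"

text \<open>In \<open>('m, 'n) cmat\<close> the rows are indexed by \<open>'m\<close> and the columns by \<open>'n\<close>.\<close>

type_synonym ('m, 'n) cmat = "complex ^ 'n ^ 'm"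

definition cinner :: "('n :: finite) cvec \<Rightarrow> 'n cvec \<Rightarrow> complex" where
  "cinner x y = (\<Sum>j\<in>UNIV. x $ j * cnj (y $ j))"

definition adj :: "('m :: finite, 'n :: finite) cmat \<Rightarrow> ('n, 'm) cmat" where
  "adj X = (\<chi> i j. cnj (X $ j $ i))"

definition hermitian :: "('n :: finite, 'n) cmat \<Rightarrow> bool" where
  "hermitian X \<longleftrightarrow> adj X = X"

text \<open>For Hermitian \<open>X\<close> the number \<open>cinner (X *v x) x\<close> is real, so nothing is lost by \<open>Re\<close>.\<close>

definition pos_def :: "('n :: finite, 'n) cmat \<Rightarrow> bool" where
  "pos_def X \<longleftrightarrow> hermitian X \<and> (\<forall>x. x \<noteq> 0 \<longrightarrow> Re (cinner (X *v x) x) > 0)"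

definition herm_less :: "('n :: finite, 'n) cmat \<Rightarrow> ('n, 'n) cmat \<Rightarrow> bool" where
  "herm_less X Y \<longleftrightarrow> pos_def (Y - X)"

text \<open>Only used for Hermitian matrices, all of whose eigenvalues are real.\<close>

definition max_eigval :: "('n :: finite, 'n) cmat \<Rightarrow> real" where
  "max_eigval X = Max {r. \<exists>v. v \<noteq> 0 \<and> X *v v = complex_of_real r *s v}"


section \<open>The space \<open>L\<^sup>2(\<Omega>)\<close>\<close>

definition rect :: "real \<Rightarrow> real \<Rightarrow> (real \<times> real) set" where
  "rect Lx Ly = {0<..<Lx} \<times> {0<..<Ly}"

text \<open>Elements of \<open>L\<^sup>2(\<Omega>)\<close> are represented by functions; equality in \<open>L\<^sup>2(\<Omega>)\<close> is equality almost
  everywhere on the rectangle.\<close>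

definition L2 :: "real \<Rightarrow> real \<Rightarrow> (real \<times> real \<Rightarrow> complex) set" where
  "L2 Lx Ly = {f. f \<in> borel_measurable (lebesgue_on (rect Lx Ly)) \<and>
                  integrable (lebesgue_on (rect Lx Ly)) (\<lambda>z. (cmod (f z))\<^sup>2)}"

definition L2_inner ::
  "real \<Rightarrow> real \<Rightarrow> (real \<times> real \<Rightarrow> complex) \<Rightarrow> (real \<times> real \<Rightarrow> complex) \<Rightarrow> complex" where
  "L2_inner Lx Ly f g =
     complex_of_real (1 / (Lx * Ly)) * (\<integral>z. f z * cnj (g z) \<partial>lebesgue_on (rect Lx Ly))"

definition L2_norm :: "real \<Rightarrow> real \<Rightarrow> (real \<times> real \<Rightarrow> complex) \<Rightarrow> real" where
  "L2_norm Lx Ly f = sqrt (Re (L2_inner Lx Ly f f))"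

text \<open>Linearity and boundedness together imply that \<open>T\<close> respects equality almost everywhere.\<close>

definition bounded_L2_operator ::
  "real \<Rightarrow> real \<Rightarrow> ((real \<times> real \<Rightarrow> complex) \<Rightarrow> (real \<times> real \<Rightarrow> complex)) \<Rightarrow> bool" where
  "bounded_L2_operator Lx Ly T \<longleftrightarrow>
     (\<forall>f\<in>L2 Lx Ly. T f \<in> L2 Lx Ly) \<and>
     (\<forall>f\<in>L2 Lx Ly. \<forall>g\<in>L2 Lx Ly.
        AE z in lebesgue_on (rect Lx Ly). T (\<lambda>z. f z + g z) z = T f z + T g z) \<and>
     (\<forall>a. \<forall>f\<in>L2 Lx Ly.
        AE z in lebesgue_on (rect Lx Ly). T (\<lambda>z. a * f z) z = a * T f z) \<and>
     (\<exists>K. \<forall>f\<in>L2 Lx Ly. L2_norm Lx Ly (T f) \<le> K * L2_norm Lx Ly f)"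

definition fourier_mode :: "real \<Rightarrow> real \<Rightarrow> int \<times> int \<Rightarrow> real \<times> real \<Rightarrow> complex" where
  "fourier_mode Lx Ly cd z =
     exp (2 * pi * \<i> * of_int (fst cd) * of_real (fst z) / of_real Lx) *
     exp (2 * pi * \<i> * of_int (snd cd) * of_real (snd z) / of_real Ly)"


section \<open>Modes\<close>

text \<open>Vectors in \<open>\<complex>\<^sup>N\<close> are indexed by a finite linearly ordered type \<open>'n\<close> with
  \<open>CARD('n) = (N1 + 1) * (N2 + 1)\<close>.  The element at position \<open>k\<close> (counted from \<open>0\<close>) carries the
  \<open>k\<close>-th mode in the lexicographic order, the first mode being \<open>(- N1/2, - N2/2)\<close>.\<close>

definition pos :: "'n :: {finite, linorder} \<Rightarrow> nat" where
  "pos i = card {j. j < i}"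

definition mode :: "nat \<Rightarrow> nat \<Rightarrow> 'n :: {finite, linorder} \<Rightarrow> int \<times> int" where
  "mode N1 N2 i = (int (pos i div (N2 + 1)) - int (N1 div 2),
                   int (pos i mod (N2 + 1)) - int (N2 div 2))"


section \<open>Matrices of the model\<close>

definition lap_eig :: "real \<Rightarrow> real \<Rightarrow> int \<times> int \<Rightarrow> real" where
  "lap_eig Lx Ly cd = 4 * pi\<^sup>2 * (of_int (fst cd))\<^sup>2 / Lx\<^sup>2 + 4 * pi\<^sup>2 * (of_int (snd cd))\<^sup>2 / Ly\<^sup>2"

definition A_mat :: "nat \<Rightarrow> nat \<Rightarrow> real \<Rightarrow> real \<Rightarrow> real \<Rightarrow> ('n :: {finite, linorder}, 'n) cmat" where
  "A_mat N1 N2 Lx Ly \<nu> =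
     (\<chi> i j. if i = j then complex_of_real (- \<nu> * lap_eig Lx Ly (mode N1 N2 i)) else 0)"

definition B_mat ::
  "nat \<Rightarrow> nat \<Rightarrow> real \<Rightarrow> real \<Rightarrow> 'n cvec \<Rightarrow> ('n :: {finite, linorder}, 'n) cmat" where
  "B_mat N1 N2 Lx Ly w = (\<chi> i j.
     let (c, d) = mode N1 N2 i; (n, m) = mode N1 N2 j in
     - (\<Sum>k | mode N1 N2 k \<noteq> (0, 0).
          let (p, q) = mode N1 N2 k in
          w $ k * complex_of_real (of_int (p * m - q * n) * Lx * Ly /
                                   ((of_int p)\<^sup>2 * Ly\<^sup>2 + (of_int q)\<^sup>2 * Lx\<^sup>2)) *
          (if p + n = c \<and> q + m = d then 1 else 0)))"

definition D_mat ::
  "nat \<Rightarrow> nat \<Rightarrow> real \<Rightarrow> real \<Rightarrow> ((real \<times> real \<Rightarrow> complex) \<Rightarrow> (real \<times> real \<Rightarrow> complex))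
     \<Rightarrow> ('n :: {finite, linorder}, 'n) cmat" where
  "D_mat N1 N2 Lx Ly T = (\<chi> i j.
     L2_inner Lx Ly (T (fourier_mode Lx Ly (mode N1 N2 j))) (fourier_mode Lx Ly (mode N1 N2 i)))"

definition H_mat ::
  "nat \<Rightarrow> nat \<Rightarrow> real \<Rightarrow> real \<Rightarrow> ('m \<Rightarrow> real \<times> real \<Rightarrow> complex)
     \<Rightarrow> ('m :: finite, 'n :: {finite, linorder}) cmat" where
  "H_mat N1 N2 Lx Ly h = (\<chi> k j. L2_inner Lx Ly (h k) (fourier_mode Lx Ly (mode N1 N2 j)))"

text \<open>The four corner blocks occupy the positions smaller and larger than the middle position \<open>n\<close>; the
  entries of the row-reversed identity are those with block indices \<open>a + b = n - 1\<close>.\<close>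

definition Psi :: "('n :: {finite, linorder}, 'n) cmat" where
  "Psi = (\<chi> i j.
     let n = (CARD('n) - 1) div 2; r = pos i; s = pos j in
     complex_of_real (1 / sqrt 2) *
     (if r < n \<and> s < n then (if r = s then 1 else 0)
      else if r < n \<and> n < s then (if r + (s - (n + 1)) + 1 = n then 1 else 0)
      else if n < r \<and> s < n then (if (r - (n + 1)) + s + 1 = n then 1 else 0)
      else if n < r \<and> n < s then (if r = s then - 1 else 0)
      else 0))"

definition B1_mat ::
  "nat \<Rightarrow> nat \<Rightarrow> real \<Rightarrow> real \<Rightarrow> 'n cvec \<Rightarrow> ('n :: {finite, linorder}, 'n) cmat" where
  "B1_mat N1 N2 Lx Ly w =
     (\<chi> i j. (B_mat N1 N2 Lx Ly (Psi *v axis j 1) *v w) $ i) ** adj Psi"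


section \<open>Differential equations\<close>

definition abs_cont_on :: "real \<Rightarrow> real \<Rightarrow> (real \<Rightarrow> 'a :: real_normed_vector) \<Rightarrow> bool" where
  "abs_cont_on a b w \<longleftrightarrow>
     (\<forall>\<epsilon>>0. \<exists>\<delta>>0. \<forall>I :: (real \<times> real) set.
        finite I \<longrightarrow> (\<forall>(u, v)\<in>I. a \<le> u \<and> u \<le> v \<and> v \<le> b) \<longrightarrow>
        disjoint_family_on (\<lambda>(u, v). {u<..<v}) I \<longrightarrow>
        (\<Sum>(u, v)\<in>I. v - u) < \<delta> \<longrightarrow> (\<Sum>(u, v)\<in>I. norm (w v - w u)) < \<epsilon>)"

text \<open>Values of \<open>w\<close> at negative times are irrelevant.\<close>

definition ode_solution ::
  "(real \<Rightarrow> 'a \<Rightarrow> 'a) \<Rightarrow> 'a \<Rightarrow> (real \<Rightarrow> 'a :: real_normed_vector) \<Rightarrow> bool" where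
  "ode_solution g w0 w \<longleftrightarrow>
     w 0 = w0 \<and> (\<forall>T>0. abs_cont_on 0 T w) \<and>
     (AE t in lebesgue_on {0..}. (w has_vector_derivative g t (w t)) (at t within {0..}))"

definition state_solution ::
  "nat \<Rightarrow> nat \<Rightarrow> real \<Rightarrow> real \<Rightarrow> real \<Rightarrow> ('n, 'n) cmat
     \<Rightarrow> ('n :: {finite, linorder}) cvec \<Rightarrow> (real \<Rightarrow> 'n cvec) \<Rightarrow> (real \<Rightarrow> 'n cvec) \<Rightarrow> bool" where
  "state_solution N1 N2 Lx Ly \<nu> D w0 f w \<longleftrightarrow>
     ode_solution (\<lambda>t x. B_mat N1 N2 Lx Ly x *v x + A_mat N1 N2 Lx Ly \<nu> *v x + D *v f t) w0 w"

definition filter_solution ::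
  "nat \<Rightarrow> nat \<Rightarrow> real \<Rightarrow> real \<Rightarrow> real \<Rightarrow> ('m :: finite, 'n) cmat
     \<Rightarrow> (real \<Rightarrow> 'n cvec \<Rightarrow> ('n, 'n) cmat)
     \<Rightarrow> (real \<Rightarrow> 'm cvec) \<Rightarrow> (real \<Rightarrow> ('n :: {finite, linorder}) cvec) \<Rightarrow> bool" where
  "filter_solution N1 N2 Lx Ly \<nu> H P y w \<longleftrightarrow>
     ode_solution (\<lambda>t x. B_mat N1 N2 Lx Ly x *v x + A_mat N1 N2 Lx Ly \<nu> *v x
                         + (P t x ** adj H) *v (y t - H *v x)) 0 w"

definition real_zero_mean ::
  "nat \<Rightarrow> nat \<Rightarrow> (real \<Rightarrow> ('n :: {finite, linorder}) cvec) \<Rightarrow> bool" where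
  "real_zero_mean N1 N2 w \<longleftrightarrow>
     (\<forall>t\<ge>0. (\<forall>i j. mode N1 N2 j = - mode N1 N2 i \<longrightarrow> w t $ j = cnj (w t $ i)) \<and>
            (\<forall>i. mode N1 N2 i = (0, 0) \<longrightarrow> w t $ i = 0))"


section \<open>The uncertainty set\<close>

text \<open>The last clause is the standing assumption on the data: the state equation has a unique
  solution on \<open>t \<ge> 0\<close>, and it represents a real-valued vorticity with zero mean.\<close>

definition uncertainty_set ::
  "nat \<Rightarrow> nat \<Rightarrow> real \<Rightarrow> real \<Rightarrow> real \<Rightarrow> ('n, 'n) cmat \<Rightarrow> ('n, 'n) cmat
     \<Rightarrow> (real \<Rightarrow> ('n, 'n) cmat) \<Rightarrow> (real \<Rightarrow> ('m :: finite, 'm) cmat)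
     \<Rightarrow> (('n :: {finite, linorder}) cvec \<times> (real \<Rightarrow> 'n cvec) \<times> (real \<Rightarrow> 'm cvec)) set" where
  "uncertainty_set N1 N2 Lx Ly \<nu> D S Q R = {(w0, f, \<eta>).
     f \<in> borel_measurable (lebesgue_on {0..}) \<and>
     \<eta> \<in> borel_measurable (lebesgue_on {0..}) \<and>
     Re (cinner (matrix_inv S *v w0) w0) \<le> 1 \<and>
     (\<forall>t\<ge>0. Re (cinner (matrix_inv (Q t) *v f t) (f t)) +
             Re (cinner (matrix_inv (R t) *v \<eta> t) (\<eta> t)) \<le> 1) \<and>
     (\<exists>w. state_solution N1 N2 Lx Ly \<nu> D w0 f w \<and>
          (\<forall>w'. state_solution N1 N2 Lx Ly \<nu> D w0 f w' \<longrightarrow> (\<forall>t\<ge>0. w' t = w t)) \<and>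
          real_zero_mean N1 N2 w)}"

end

theory Submission
  imports Defs
begin

text \<open>
  Let \<open>e\<close> be the estimation error \<open>\<omega> - \<omega>hat\<close> and let \<open>\<sigma>\<close> be its squared norm.  The quadratic
  nonlinearity splits as \<open>B(\<omega>)\<omega> - B(\<omega>hat)\<omega>hat = B(\<omega>)e + B(e)\<omega>hat\<close>.  Three facts turn the resulting
  equation for \<open>e\<close> into a scalar differential inequality for \<open>\<sigma>\<close>.

  \<^item> For a real-valued vorticity \<open>\<omega>\<close> the matrix \<open>B(\<omega>)\<close> is skew-Hermitian (lemma \<open>B_mat_skew\<close>),
    so the first term does not contribute to the energy.  This is the energy neutrality of transport by
    a divergence-free velocity.

  \<^item> The second term is linear in \<open>e\<close> and equals \<open>B1(\<omega>hat) e\<close> (lemma \<open>B1_mat_mult\<close>): \<open>\<Psi>\<close> is a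
    Hermitian involution on all modes except \<open>(0,0)\<close>, and \<open>B\<close> does not see the mode \<open>(0,0)\<close>.

  \<^item> The disturbances enter linearly, and Young's inequality with the weights \<open>Q\<close> and \<open>R\<close> (lemma
    \<open>young_pos_def\<close>) bounds their contribution by the two quadratic forms in the matrix inequality
    plus the weighted size of the disturbances, which is at most \<open>1\<close>.

  Together with \<open>(Ae,e) \<le> - \<bar>\<lambda>(A)\<bar> \<sigma>\<close>, which holds because no eigenvalue of \<open>A\<close> is positive, the matrix
  inequality gives \<open>\<sigma>' \<le> 1 - (2\<bar>\<lambda>(A)\<bar> + q) \<sigma>\<close> almost everywhere (lemma \<open>error_energy_bound\<close>), and the
  ellipsoid of initial states gives \<open>\<sigma>(0) \<le> \<lambda>(S)\<close> (lemma \<open>norm_le_max_eigval\<close>).  A Gronwall argument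
  (lemma \<open>abs_cont_gronwall\<close>) then yields the bound.  Since the equations hold only almost everywhere,
  that argument rests on the fact that an absolutely continuous function whose derivative is almost
  everywhere nonpositive is nonincreasing (lemma \<open>abs_cont_on_nonincreasing\<close>).

  Throughout, the real part of the complex inner product is the real inner product of the Euclidean
  space \<open>\<complex>\<^sup>n\<close>, and all energy estimates are carried out with the latter.
\<close>


section \<open>Absolutely continuous functions\<close>

text \<open>The closure properties needed below all come from one comparison: increments controlled by those of
  two absolutely continuous functions force absolute continuity.\<close>

lemma abs_cont_on_dominated:
  fixes u :: "real \<Rightarrow> 'a::real_normed_vector" and v :: "real \<Rightarrow> 'b::real_normed_vector"
    and g :: "real \<Rightarrow> 'c::real_normed_vector"
  assumes u: "abs_cont_on a b u" and v: "abs_cont_on a b v" and "L > 0"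
    and dom: "\<And>s t. \<lbrakk>a \<le> s; s \<le> t; t \<le> b\<rbrakk> \<Longrightarrow>
               norm (g t - g s) \<le> L * (norm (u t - u s) + norm (v t - v s))"
  shows "abs_cont_on a b g"
  unfolding abs_cont_on_def
proof (intro allI impI)
  fix \<epsilon> :: real assume "\<epsilon> > 0"
  then have \<epsilon>: "\<epsilon> / (2 * L) > 0" using \<open>L > 0\<close> by simp
  obtain d1 where d1: "d1 > 0" "\<And>I. \<lbrakk>finite I; \<forall>(p, q)\<in>I. a \<le> p \<and> p \<le> q \<and> q \<le> b;
      disjoint_family_on (\<lambda>(p, q). {p<..<q}) I; (\<Sum>(p, q)\<in>I. q - p) < d1\<rbrakk>
      \<Longrightarrow> (\<Sum>(p, q)\<in>I. norm (u q - u p)) < \<epsilon> / (2 * L)"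
    using u \<epsilon> unfolding abs_cont_on_def by meson
  obtain d2 where d2: "d2 > 0" "\<And>I. \<lbrakk>finite I; \<forall>(p, q)\<in>I. a \<le> p \<and> p \<le> q \<and> q \<le> b;
      disjoint_family_on (\<lambda>(p, q). {p<..<q}) I; (\<Sum>(p, q)\<in>I. q - p) < d2\<rbrakk>
      \<Longrightarrow> (\<Sum>(p, q)\<in>I. norm (v q - v p)) < \<epsilon> / (2 * L)"
    using v \<epsilon> unfolding abs_cont_on_def by meson
  have "(\<Sum>(p, q)\<in>I. norm (g q - g p)) < \<epsilon>"
    if I: "finite I" "\<forall>(p, q)\<in>I. a \<le> p \<and> p \<le> q \<and> q \<le> b"
      "disjoint_family_on (\<lambda>(p, q). {p<..<q}) I" "(\<Sum>(p, q)\<in>I. q - p) < min d1 d2" for I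
  proof -
    have "(\<Sum>(p, q)\<in>I. norm (g q - g p))
        \<le> (\<Sum>(p, q)\<in>I. L * (norm (u q - u p) + norm (v q - v p)))"
      using I(2) by (intro sum_mono) (auto intro!: dom)
    also have "\<dots> = L * ((\<Sum>(p, q)\<in>I. norm (u q - u p)) + (\<Sum>(p, q)\<in>I. norm (v q - v p)))"
      by (simp add: sum_distrib_left sum.distrib[symmetric] case_prod_unfold)
    also have "\<dots> < L * (\<epsilon> / (2 * L) + \<epsilon> / (2 * L))"
      using d1(2)[OF I(1-3)] d2(2)[OF I(1-3)] I(4) \<open>L > 0\<close> by (intro mult_strict_left_mono) auto
    also have "\<dots> = \<epsilon>" using \<open>L > 0\<close> by (simp add: field_simps)
    finally show ?thesis .
  qed
  then show "\<exists>\<delta>>0. \<forall>I. finite I \<longrightarrow> (\<forall>(p, q)\<in>I. a \<le> p \<and> p \<le> q \<and> q \<le> b) \<longrightarrow>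
      disjoint_family_on (\<lambda>(p, q). {p<..<q}) I \<longrightarrow> (\<Sum>(p, q)\<in>I. q - p) < \<delta> \<longrightarrow>
      (\<Sum>(p, q)\<in>I. norm (g q - g p)) < \<epsilon>"
    using d1(1) d2(1) by (intro exI[of _ "min d1 d2"]) auto
qed

lemma abs_cont_on_ident: "abs_cont_on a b (\<lambda>t. t :: real)"
  unfolding abs_cont_on_def
proof (intro allI impI)
  fix \<epsilon> :: real assume "\<epsilon> > 0"
  moreover have "(\<Sum>(p, q)\<in>I. norm (q - p)) = (\<Sum>(p, q)\<in>I. q - p)"
    if "\<forall>(p, q)\<in>I. a \<le> p \<and> p \<le> q \<and> q \<le> b" for I
    using that by (intro sum.cong) auto
  ultimately show "\<exists>\<delta>>0. \<forall>I. finite I \<longrightarrow> (\<forall>(p, q)\<in>I. a \<le> p \<and> p \<le> q \<and> q \<le> b) \<longrightarrow>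
      disjoint_family_on (\<lambda>(p, q). {p<..<q}) I \<longrightarrow> (\<Sum>(p, q)\<in>I. q - p) < \<delta> \<longrightarrow>
      (\<Sum>(p, q)\<in>I. norm (q - p)) < \<epsilon>"
    by (intro exI[of _ \<epsilon>]) auto
qed

lemma abs_cont_on_diff:
  assumes "abs_cont_on a b u" "abs_cont_on a b v"
  shows "abs_cont_on a b (\<lambda>t. u t - v t)"
  using assms
proof (rule abs_cont_on_dominated[where L = 1])
  fix s t
  have "u t - v t - (u s - v s) = (u t - u s) - (v t - v s)" by simp
  then show "norm (u t - v t - (u s - v s)) \<le> 1 * (norm (u t - u s) + norm (v t - v s))"
    by (metis mult_1 norm_triangle_ineq4)
qed simp

lemma abs_cont_on_imp_continuous_on:
  assumes "abs_cont_on a b u"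
  shows "continuous_on {a..b} u"
proof (rule continuous_onI)
  fix x \<epsilon> :: real assume x: "x \<in> {a..b}" and "\<epsilon> > 0"
  obtain d where d: "d > 0" "\<And>I. \<lbrakk>finite I; \<forall>(p, q)\<in>I. a \<le> p \<and> p \<le> q \<and> q \<le> b;
      disjoint_family_on (\<lambda>(p, q). {p<..<q}) I; (\<Sum>(p, q)\<in>I. q - p) < d\<rbrakk>
      \<Longrightarrow> (\<Sum>(p, q)\<in>I. norm (u q - u p)) < \<epsilon>"
    using assms \<open>\<epsilon> > 0\<close> unfolding abs_cont_on_def by meson
  have "dist (u y) (u x) \<le> \<epsilon>" if y: "y \<in> {a..b}" "dist y x < d" for y
    using d(2)[of "{(min x y, max x y)}"] x y
    by (auto simp: disjoint_family_on_def dist_norm min_def max_def norm_minus_commute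
        abs_if split: if_splits)
  then show "\<exists>d>0. \<forall>y\<in>{a..b}. dist y x < d \<longrightarrow> dist (u y) (u x) \<le> \<epsilon>"
    using d(1) by blast
qed

text \<open>Boundedness of both factors on the compact interval makes a product dominated by its
  factors.\<close>

lemma abs_cont_on_bilinear:
  assumes "bounded_bilinear pr" and u: "abs_cont_on a b u" and v: "abs_cont_on a b v"
  shows "abs_cont_on a b (\<lambda>t. pr (u t) (v t))"
proof -
  interpret bounded_bilinear pr by fact
  have "bounded (u ` {a..b})" "bounded (v ` {a..b})"
    using u v by (auto intro!: compact_imp_bounded compact_continuous_image
        abs_cont_on_imp_continuous_on)
  then obtain M1 M2 where M: "\<forall>t\<in>{a..b}. norm (u t) \<le> M1" "\<forall>t\<in>{a..b}. norm (v t) \<le> M2"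
    unfolding bounded_iff by auto
  define M where "M = max 1 (max M1 M2)"
  have M: "M > 0" "\<And>t. t \<in> {a..b} \<Longrightarrow> norm (u t) \<le> M" "\<And>t. t \<in> {a..b} \<Longrightarrow> norm (v t) \<le> M"
    using M unfolding M_def by (auto simp: le_max_iff_disj)
  obtain K where K: "K > 0" "\<And>x y. norm (pr x y) \<le> norm x * norm y * K"
    using pos_bounded by auto
  from u v show ?thesis
  proof (rule abs_cont_on_dominated[where L = "K * M"])
    show "0 < K * M" using K M by simp
    fix s t assume st: "a \<le> s" "s \<le> t" "t \<le> b"
    have "pr (u t) (v t) - pr (u s) (v s) = pr (u t) (v t - v s) + pr (u t - u s) (v s)"
      by (simp add: diff_left diff_right)
    then have "norm (pr (u t) (v t) - pr (u s) (v s))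
        \<le> norm (pr (u t) (v t - v s)) + norm (pr (u t - u s) (v s))"
      by (metis norm_triangle_ineq)
    also have "\<dots> \<le> norm (u t) * norm (v t - v s) * K + norm (u t - u s) * norm (v s) * K"
      by (intro add_mono K)
    also have "\<dots> \<le> M * norm (v t - v s) * K + norm (u t - u s) * M * K"
      using st K M(1) by (intro add_mono mult_mono M) auto
    finally show "norm (pr (u t) (v t) - pr (u s) (v s))
        \<le> K * M * (norm (u t - u s) + norm (v t - v s))"
      by (simp add: algebra_simps)
  qed
qed

lemma abs_cont_on_exp: "abs_cont_on a b (\<lambda>t. exp (k * t) :: real)"
proof -
  define L where "L = (1 + \<bar>k\<bar>) * exp (\<bar>k\<bar> * max \<bar>a\<bar> \<bar>b\<bar>)"
  show ?thesis
  proof (rule abs_cont_on_dominated[OF abs_cont_on_ident abs_cont_on_ident])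
    show "L > 0" unfolding L_def by (intro mult_pos_pos) auto
    fix s t assume st: "a \<le> s" "s \<le> t" "t \<le> b"
    have "norm (exp (k * t) - exp (k * s)) \<le> L * norm (t - s)"
    proof (rule field_differentiable_bound[where S = "{a..b}" and f' = "\<lambda>x. k * exp (k * x)"])
      fix x assume x: "x \<in> {a..b}"
      show "((\<lambda>t. exp (k * t)) has_field_derivative k * exp (k * x)) (at x within {a..b})"
        by (auto intro!: derivative_eq_intros)
      have "k * x \<le> \<bar>k\<bar> * \<bar>x\<bar>" by (metis abs_ge_self abs_mult)
      also have "\<dots> \<le> \<bar>k\<bar> * max \<bar>a\<bar> \<bar>b\<bar>" using x by (intro mult_left_mono) auto
      finally show "norm (k * exp (k * x)) \<le> L"
        unfolding L_def by (auto simp: abs_mult intro!: mult_mono)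
    qed (use st in auto)
    also have "\<dots> \<le> L * (norm (t - s) + norm (t - s))"
      using \<open>L > 0\<close> by (intro mult_left_mono) auto
    finally show "norm (exp (k * t) - exp (k * s)) \<le> L * (norm (t - s) + norm (t - s))" .
  qed
qed

text \<open>The null set where there is no nonpositive derivative is covered by an open set \<open>U\<close> so small that
  absolute continuity makes the sum of the increments over disjoint intervals inside \<open>U\<close> small.
  At every other point the derivative controls the increment over any sufficiently small interval
  around that point.  A gauge encodes both requirements, and the existence of a fine tagged division
  (Cousin's lemma) leaves finitely many increments to add up.\<close>

lemma abs_cont_on_nonincreasing:
  fixes g :: "real \<Rightarrow> real"
  assumes "a \<le> b" and ac: "abs_cont_on a b g"
    and deriv: "AE t in lebesgue. t \<in> {a..b} \<longrightarrow>
                  (\<exists>D\<le>0. (g has_real_derivative D) (at t within {a..b}))"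
  shows "g b \<le> g a"
proof (rule field_le_epsilon)
  fix \<epsilon>0 :: real assume "\<epsilon>0 > 0"
  \<comment> \<open>The exceptional intervals will cost \<open>\<epsilon>\<close> in total, the others \<open>\<epsilon>\<close> per unit length.\<close>
  define \<epsilon> where "\<epsilon> = \<epsilon>0 / (1 + (b - a))"
  have \<epsilon>: "\<epsilon> > 0" "\<epsilon> * (1 + (b - a)) = \<epsilon>0"
    using \<open>\<epsilon>0 > 0\<close> \<open>a \<le> b\<close> unfolding \<epsilon>_def by auto
  obtain \<delta> where \<delta>: "\<delta> > 0" "\<And>I. \<lbrakk>finite I; \<forall>(p, q)\<in>I. a \<le> p \<and> p \<le> q \<and> q \<le> b;
      disjoint_family_on (\<lambda>(p, q). {p<..<q}) I; (\<Sum>(p, q)\<in>I. q - p) < \<delta>\<rbrakk>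
      \<Longrightarrow> (\<Sum>(p, q)\<in>I. norm (g q - g p)) < \<epsilon>"
    using ac \<epsilon>(1) unfolding abs_cont_on_def by meson
  obtain Z where Z: "Z \<in> null_sets lebesgue"
    "\<And>t. t \<in> {a..b} - Z \<Longrightarrow> \<exists>D\<le>0. (g has_real_derivative D) (at t within {a..b})"
  proof (rule AE_E3[OF deriv])
    fix Z assume "Z \<in> null_sets lebesgue" and "\<And>t. t \<in> space lebesgue - Z \<Longrightarrow>
      t \<in> {a..b} \<longrightarrow> (\<exists>D\<le>0. (g has_real_derivative D) (at t within {a..b}))"
    then show thesis by (intro that[of Z]) simp_all
  qed
  obtain U where U: "open U" "Z \<subseteq> U" "U - Z \<in> lmeasurable" "emeasure lebesgue (U - Z) < ennreal \<delta>"
    using sets_lebesgue_outer_open[OF null_setsD2[OF Z(1)] \<delta>(1)] by metis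
  have emU: "emeasure lebesgue U < ennreal \<delta>"
    using U(1,4) emeasure_Diff_null_set[OF Z(1), of U] by auto
  have Um: "U \<in> lmeasurable"
    using U(1) emU by (auto simp: fmeasurable_def less_top intro: order.strict_trans)
  have mU: "measure lebesgue U < \<delta>"
    using emU \<open>\<delta> > 0\<close> by (simp add: emeasure_eq_measure2[OF Um] ennreal_less_iff)
  have "\<exists>d>0. (t \<in> Z \<longrightarrow> ball t d \<subseteq> U) \<and>
      (t \<in> {a..b} - Z \<longrightarrow> (\<forall>u v. {u, v} \<subseteq> ball t d \<longrightarrow> a \<le> u \<longrightarrow> u \<le> t \<longrightarrow> t \<le> v \<longrightarrow> v \<le> b \<longrightarrow>
                             g v - g u \<le> \<epsilon> * (v - u)))" for t
  proof (cases "t \<in> {a..b} - Z")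
    case False
    show ?thesis
    proof (cases "t \<in> Z")
      case True
      with U obtain d where "d > 0" "ball t d \<subseteq> U" by (meson openE subsetD)
      with True show ?thesis by auto
    qed (use False in \<open>auto intro!: exI[of _ 1]\<close>)
  next
    case True
    with Z(2) obtain D where D: "D \<le> 0" "(g has_real_derivative D) (at t within {a..b})" by blast
    then obtain d where d: "d > 0"
      "\<And>y. y \<in> {a..b} \<Longrightarrow> \<bar>y - t\<bar> < d \<Longrightarrow> \<bar>g y - g t - D * (y - t)\<bar> \<le> \<epsilon> * \<bar>y - t\<bar>"
      using \<epsilon>(1) unfolding has_field_derivative_def has_derivative_within_alt by force
    have "g v - g u \<le> \<epsilon> * (v - u)"
      if "{u, v} \<subseteq> ball t d" "a \<le> u" "u \<le> t" "t \<le> v" "v \<le> b" for u v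
    proof -
      have "\<bar>g v - g t - D * (v - t)\<bar> \<le> \<epsilon> * (v - t)" "\<bar>g u - g t - D * (u - t)\<bar> \<le> \<epsilon> * (t - u)"
        using d(2)[of v] d(2)[of u] that by (auto simp: dist_real_def abs_minus_commute)
      moreover have "D * (v - u) \<le> 0" using D(1) that by (simp add: mult_nonpos_nonneg)
      ultimately show ?thesis by (simp add: algebra_simps)
    qed
    with True d(1) show ?thesis by auto
  qed
  then obtain d where d: "\<And>t. d t > 0" "\<And>t. t \<in> Z \<Longrightarrow> ball t (d t) \<subseteq> U"
    "\<And>t u v. \<lbrakk>t \<in> {a..b} - Z; {u, v} \<subseteq> ball t (d t); a \<le> u; u \<le> t; t \<le> v; v \<le> b\<rbrakk>
       \<Longrightarrow> g v - g u \<le> \<epsilon> * (v - u)"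
    by metis
  have "gauge (\<lambda>t. ball t (d t))" using d(1) by (simp add: gauge_ball_dependent)
  then obtain p where p: "p tagged_division_of {a..b}" "(\<lambda>t. ball t (d t)) fine p"
    using fine_division_exists_real by blast
  have fin: "finite p" using p(1) by auto
  have K: "K = {Inf K..Sup K} \<and> a \<le> Inf K \<and> Inf K \<le> x \<and> x \<le> Sup K \<and> Sup K \<le> b
      \<and> {Inf K..Sup K} \<subseteq> ball x (d x)" if xK: "(x, K) \<in> p" for x K
  proof -
    obtain u v where "K = {u..v}" using tagged_division_ofD(4)[OF p(1) xK] by auto
    moreover have "x \<in> K" "K \<subseteq> {a..b}" using tagged_division_ofD(2,3)[OF p(1) xK] by auto
    moreover have "K \<subseteq> ball x (d x)" using p(2) xK by (auto simp: fine_def)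
    ultimately show ?thesis by auto
  qed
  \<comment> \<open>Degenerate intervals are left out because they contribute nothing and could destroy the injectivity
    of the passage from tagged intervals to pairs of end points.\<close>
  define bad where "bad = {(x, K) \<in> p. x \<in> Z \<and> Inf K < Sup K}"
  define I where "I = (\<lambda>(x, K). (Inf K, Sup K)) ` bad"
  have bad: "bad \<subseteq> p" unfolding bad_def by auto
  then have finbad: "finite bad" using fin by (rule finite_subset)
  have disj: "{Inf K<..<Sup K} \<inter> {Inf K'<..<Sup K'} = {}"
    if "(x, K) \<in> bad" "(x', K') \<in> bad" "(x, K) \<noteq> (x', K')" for x K x' K'
  proof -
    have "(x, K) \<in> p" "(x', K') \<in> p" using that bad by auto
    then have "interior K \<inter> interior K' = {}" using tagged_division_ofD(5)[OF p(1)] that(3) by blast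
    moreover have "interior K = {Inf K<..<Sup K}" "interior K' = {Inf K'<..<Sup K'}"
      using K[OF \<open>(x, K) \<in> p\<close>] K[OF \<open>(x', K') \<in> p\<close>] by (metis interior_atLeastAtMost_real)+
    ultimately show ?thesis by simp
  qed
  have inj: "inj_on (\<lambda>(x, K). (Inf K, Sup K)) bad"
  proof (rule inj_onI, clarify)
    fix x K x' K' assume *: "(x, K) \<in> bad" "(x', K') \<in> bad" "Inf K = Inf K'" "Sup K = Sup K'"
    then have "{Inf K<..<Sup K} \<noteq> {}" unfolding bad_def by auto
    with disj[OF *(1,2)] *(3,4) show "x = x' \<and> K = K'" by auto
  qed
  have disjI: "disjoint_family_on (\<lambda>(u, v). {u<..<v}) I"
    unfolding disjoint_family_on_def I_def using disj by fastforce
  have I: "finite I" "\<forall>(u, v)\<in>I. a \<le> u \<and> u \<le> v \<and> v \<le> b"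
    unfolding I_def using finbad bad K by fastforce+
  have "(\<Sum>(u, v)\<in>I. v - u) = (\<Sum>i\<in>I. measure lebesgue ((\<lambda>(u, v). {u<..<v}) i))"
    using I(2) by (intro sum.cong) auto
  also have "\<dots> = measure lebesgue (\<Union>i\<in>I. (\<lambda>(u, v). {u<..<v}) i)"
    by (rule measure_finite_Union[symmetric]) (use I disjI in \<open>auto simp: emeasure_lborel_Ioo\<close>)
  also have "\<dots> \<le> measure lebesgue U"
  proof (rule measure_mono_fmeasurable[OF _ _ Um])
    show "(\<Union>i\<in>I. (\<lambda>(u, v). {u<..<v}) i) \<subseteq> U"
    proof (clarsimp simp: I_def)
      fix y x K assume *: "(x, K) \<in> bad" "Inf K < y" "y < Sup K"
      then have "x \<in> Z" "(x, K) \<in> p" unfolding bad_def by auto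
      with K[of x K] * d(2)[of x] show "y \<in> U" by fastforce
    qed
  qed (use I(1) in \<open>auto intro!: sets.finite_UN\<close>)
  finally have "(\<Sum>(u, v)\<in>I. v - u) < \<delta>" using mU by simp
  from \<delta>(2)[OF I disjI this]
  have "(\<Sum>(x, K)\<in>bad. norm (g (Sup K) - g (Inf K))) < \<epsilon>"
    unfolding I_def by (subst (asm) sum.reindex[OF inj]) (simp add: case_prod_unfold comp_def)
  then have badsum: "(\<Sum>(x, K)\<in>bad. g (Sup K) - g (Inf K)) \<le> \<epsilon>"
    by (smt (verit) sum_mono case_prod_unfold real_norm_def)
  have "(\<Sum>(x, K)\<in>p - bad. g (Sup K) - g (Inf K)) \<le> (\<Sum>(x, K)\<in>p - bad. \<epsilon> * (Sup K - Inf K))"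
  proof (rule sum_mono, clarify)
    fix x K assume *: "(x, K) \<in> p" "(x, K) \<notin> bad"
    show "g (Sup K) - g (Inf K) \<le> \<epsilon> * (Sup K - Inf K)"
    proof (cases "x \<in> Z")
      case True
      with * K[OF *(1)] have "Inf K = Sup K" unfolding bad_def by auto
      then show ?thesis by simp
    next
      case False
      have "{Inf K, Sup K} \<subseteq> ball x (d x)" using K[OF *(1)] by (auto simp: subset_iff)
      then show ?thesis using d(3)[of x "Inf K" "Sup K"] K[OF *(1)] False by auto
    qed
  qed
  also have "\<dots> \<le> (\<Sum>(x, K)\<in>p. \<epsilon> * (Sup K - Inf K))"
    using fin \<epsilon>(1) K by (intro sum_mono2) (fastforce intro!: mult_nonneg_nonneg)+
  also have "\<dots> = \<epsilon> * (b - a)"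
    using additive_tagged_division_1[OF \<open>a \<le> b\<close> p(1), of "\<lambda>x. x"]
    by (simp add: sum_distrib_left[symmetric] case_prod_unfold)
  finally have "(\<Sum>(x, K)\<in>p. g (Sup K) - g (Inf K)) \<le> \<epsilon> * (b - a) + \<epsilon>"
    using badsum sum.subset_diff[OF bad fin, of "\<lambda>(x, K). g (Sup K) - g (Inf K)"] by linarith
  then show "g b \<le> g a + \<epsilon>0"
    using additive_tagged_division_1[OF \<open>a \<le> b\<close> p(1), of g] \<epsilon>(2) by (simp add: algebra_simps)
qed

text \<open>The inequality says that \<open>exp (k t) (\<bar>e(t)\<bar>\<^sup>2 - 1 / k)\<close> has a nonpositive derivative; the constant \<open>1 / k\<close>
  is the equilibrium of the comparison equation \<open>\<sigma>' = 1 - k \<sigma>\<close>.\<close>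

lemma abs_cont_gronwall:
  fixes e :: "real \<Rightarrow> 'a :: real_inner"
  assumes "k > 0" "T \<ge> 0" and ac: "abs_cont_on 0 T e"
    and deriv: "AE t in lebesgue. t \<in> {0..T} \<longrightarrow>
      (\<exists>e'. (e has_vector_derivative e') (at t within {0..T}) \<and> 2 * (e' \<bullet> e t) \<le> 1 - k * (e t \<bullet> e t))"
  shows "e T \<bullet> e T \<le> 1 / k + (e 0 \<bullet> e 0 - 1 / k) * exp (- k * T)"
proof -
  define g where "g t = exp (k * t) * (e t \<bullet> e t - 1 / k)" for t
  have const: "abs_cont_on 0 T (\<lambda>t. 1 / k)"
    by (rule abs_cont_on_dominated[OF ac ac, of 1]) auto
  have "abs_cont_on 0 T g"
    unfolding g_def
    by (intro abs_cont_on_bilinear[OF bounded_bilinear_mult] abs_cont_on_exp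
        abs_cont_on_diff abs_cont_on_bilinear[OF bounded_bilinear_inner] ac const)
  moreover have "AE t in lebesgue. t \<in> {0..T} \<longrightarrow>
      (\<exists>D\<le>0. (g has_real_derivative D) (at t within {0..T}))"
    using deriv
  proof eventually_elim
    case (elim t)
    show ?case
    proof
      assume "t \<in> {0..T}"
      with elim obtain e' where e': "(e has_vector_derivative e') (at t within {0..T})"
        "2 * (e' \<bullet> e t) \<le> 1 - k * (e t \<bullet> e t)" by blast
      let ?D = "exp (k * t) * (2 * (e' \<bullet> e t)) + k * exp (k * t) * (e t \<bullet> e t - 1 / k)"
      have "((\<lambda>t. e t \<bullet> e t) has_derivative (\<lambda>h. e t \<bullet> (h *\<^sub>R e') + (h *\<^sub>R e') \<bullet> e t))
          (at t within {0..T})"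
        by (rule has_derivative_inner) (use e'(1) in \<open>simp_all add: has_vector_derivative_def\<close>)
      moreover have "(\<lambda>h. e t \<bullet> (h *\<^sub>R e') + (h *\<^sub>R e') \<bullet> e t) = (*) (2 * (e' \<bullet> e t))"
        by (simp add: fun_eq_iff inner_commute)
      ultimately have "((\<lambda>t. e t \<bullet> e t) has_real_derivative 2 * (e' \<bullet> e t)) (at t within {0..T})"
        by (simp add: has_field_derivative_def)
      then have "(g has_real_derivative ?D) (at t within {0..T})"
        unfolding g_def by (auto intro!: derivative_eq_intros)
      moreover have "?D \<le> 0"
      proof -
        have "?D = exp (k * t) * (2 * (e' \<bullet> e t) + k * (e t \<bullet> e t) - 1)"
          using \<open>k > 0\<close> by (simp add: field_simps)
        also have "\<dots> \<le> 0" using e'(2) by (intro mult_nonneg_nonpos) auto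
        finally show ?thesis .
      qed
      ultimately show "\<exists>D\<le>0. (g has_real_derivative D) (at t within {0..T})" by blast
    qed
  qed
  ultimately have "g T \<le> g 0" by (rule abs_cont_on_nonincreasing[OF \<open>T \<ge> 0\<close>])
  then have "exp (- k * T) * g T \<le> exp (- k * T) * g 0" by (intro mult_left_mono) auto
  also have "exp (- k * T) * g T = e T \<bullet> e T - 1 / k"
    unfolding g_def by (simp add: mult.assoc[symmetric] exp_add[symmetric])
  finally show ?thesis by (simp add: g_def algebra_simps)
qed


section \<open>Hermitian and positive definite matrices\<close>

lemma Re_cinner: "Re (cinner x y) = x \<bullet> y"
  by (simp add: cinner_def inner_vec_def inner_complex_def)

lemma inner_adj:
  fixes X :: "('m :: finite, 'n :: finite) cmat"
  shows "(X *v x) \<bullet> y = x \<bullet> (adj X *v y)"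
proof -
  have "cinner (X *v x) y = (\<Sum>i\<in>UNIV. \<Sum>j\<in>UNIV. X $ i $ j * x $ j * cnj (y $ i))"
    by (simp add: cinner_def matrix_vector_mult_def sum_distrib_right)
  also have "\<dots> = (\<Sum>j\<in>UNIV. \<Sum>i\<in>UNIV. X $ i $ j * x $ j * cnj (y $ i))"
    by (rule sum.swap)
  also have "\<dots> = cinner x (adj X *v y)"
    by (simp add: cinner_def matrix_vector_mult_def adj_def sum_distrib_left mult_ac)
  finally show ?thesis by (metis Re_cinner)
qed

lemma adj_adj [simp]: "adj (adj X) = X"
  by (simp add: adj_def vec_eq_iff)

lemma adj_mult: "adj (X ** Y) = adj Y ** adj X"
  by (simp add: adj_def matrix_matrix_mult_def vec_eq_iff mult.commute)

lemma pos_def_hermitian: "pos_def X \<Longrightarrow> hermitian X"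
  by (simp add: pos_def_def)

lemma pos_def_inner_nonneg: "pos_def X \<Longrightarrow> (X *v x) \<bullet> x \<ge> 0"
  by (cases "x = 0") (auto simp: pos_def_def Re_cinner less_imp_le)

lemma hermitian_inner: "hermitian X \<Longrightarrow> (X *v x) \<bullet> y = x \<bullet> (X *v y)"
  by (simp add: hermitian_def inner_adj)

lemma pos_def_matrix_inv:
  assumes "pos_def X"
  shows "X *v (matrix_inv X *v x) = x"
proof -
  have "\<forall>x. X *v x = 0 \<longrightarrow> x = 0"
    using assms by (force simp: pos_def_def Re_cinner)
  then have "invertible X"
    by (simp add: matrix_left_invertible_ker[symmetric] invertible_left_inverse)
  then have "X ** matrix_inv X = mat 1"
    unfolding invertible_def matrix_inv_def by (rule someI2_ex) simp
  then show ?thesis by (simp add: matrix_vector_mul_assoc)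
qed

text \<open>This expands \<open>(X (y - z), y - z) \<ge> 0\<close> for \<open>z = X\<^sup>-\<^sup>1 x\<close>.\<close>

lemma young_pos_def:
  assumes "pos_def X"
  shows "2 * (x \<bullet> y) \<le> (X *v y) \<bullet> y + (matrix_inv X *v x) \<bullet> x"
proof -
  define z where "z = matrix_inv X *v x"
  have z: "X *v z = x" unfolding z_def by (rule pos_def_matrix_inv[OF assms])
  have "0 \<le> (X *v (y - z)) \<bullet> (y - z)" by (rule pos_def_inner_nonneg[OF assms])
  also have "\<dots> = (X *v y) \<bullet> y - (X *v y) \<bullet> z - x \<bullet> y + x \<bullet> z"
    by (simp add: matrix_vector_mult_diff_distrib inner_diff_left inner_diff_right z)
  also have "(X *v y) \<bullet> z = x \<bullet> y"
    using hermitian_inner[OF pos_def_hermitian[OF assms]] z by (metis inner_commute)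
  finally show ?thesis by (simp add: z_def[symmetric] inner_commute)
qed

lemma smult_of_real: "complex_of_real r *s v = r *\<^sub>R v"
  by (simp add: vec_eq_iff scaleR_conv_of_real[symmetric])

text \<open>Eigenvectors to different eigenvalues are orthogonal, hence linearly independent.  Finiteness is
  what makes the \<open>Max\<close> in \<open>max_eigval\<close> an actual maximum.\<close>

lemma finite_hermitian_eigenvalues:
  assumes "hermitian X"
  shows "finite {r. \<exists>v. v \<noteq> 0 \<and> X *v v = complex_of_real r *s v}" (is "finite ?E")
proof -
  define E where "E = ?E"
  define V where "V r = (SOME v. v \<noteq> 0 \<and> X *v v = complex_of_real r *s v)" for r
  have V: "V r \<noteq> 0 \<and> X *v V r = complex_of_real r *s V r" if "r \<in> E" for r
  proof -
    have "\<exists>v. v \<noteq> 0 \<and> X *v v = complex_of_real r *s v" using that unfolding E_def by simp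
    then show ?thesis unfolding V_def by (rule someI_ex)
  qed
  have orth: "V r \<bullet> V s = 0" if "r \<in> E" "s \<in> E" "r \<noteq> s" for r s
  proof -
    have "r * (V r \<bullet> V s) = s * (V r \<bullet> V s)"
      using hermitian_inner[OF assms, of "V r" "V s"] V[OF that(1)] V[OF that(2)]
      by (simp add: smult_of_real)
    then show ?thesis using that(3) by simp
  qed
  have "inj_on V E"
  proof (rule inj_onI, rule ccontr)
    fix r s assume "r \<in> E" "s \<in> E" "V r = V s" "r \<noteq> s"
    then show False using orth[of r s] V[of r] by simp
  qed
  moreover have "independent (V ` E)"
  proof (rule pairwise_orthogonal_independent)
    show "pairwise orthogonal (V ` E)"
      unfolding pairwise_def orthogonal_def using orth by auto
    show "0 \<notin> V ` E" using V by force
  qed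
  ultimately have "finite E" using independent_bound finite_imageD by blast
  then show ?thesis unfolding E_def .
qed

text \<open>The Rayleigh quotient attains its maximum \<open>\<mu>\<close> on the compact unit sphere, and the first-order
  condition at a maximizer \<open>v\<close> is the eigenvalue equation.  The condition is extracted by varying \<open>v\<close> in the
  direction of the residual \<open>y = \<mu> v - X v\<close>.\<close>

lemma hermitian_rayleigh_eigenvalue:
  fixes X :: "('n :: finite, 'n) cmat"
  assumes "hermitian X"
  obtains \<mu> v where "v \<noteq> 0" "X *v v = complex_of_real \<mu> *s v" "\<And>x. (X *v x) \<bullet> x \<le> \<mu> * (x \<bullet> x)"
proof -
  have lin: "bounded_linear (\<lambda>x. X *v x)"
    by (rule linear_conv_bounded_linear[THEN iffD1])
       (auto intro!: linearI simp: matrix_vector_right_distrib smult_of_real[symmetric] vector_scalar_commute)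
  have "\<exists>v\<in>sphere 0 1. \<forall>x\<in>sphere 0 1. (X *v x) \<bullet> x \<le> (X *v v) \<bullet> v"
  proof (rule continuous_attains_sup)
    show "compact (sphere (0::'n cvec) 1)" by simp
    have "norm (axis undefined 1 :: 'n cvec) = 1" by (simp add: norm_axis_1)
    then show "sphere (0::'n cvec) 1 \<noteq> {}" by (metis empty_iff mem_sphere_0)
    show "continuous_on (sphere 0 1) (\<lambda>x. (X *v x) \<bullet> x)"
      by (intro continuous_intros linear_continuous_on lin)
  qed
  then obtain v where v: "norm v = 1" "\<And>x. norm x = 1 \<Longrightarrow> (X *v x) \<bullet> x \<le> (X *v v) \<bullet> v"
    by auto
  define \<mu> where "\<mu> = (X *v v) \<bullet> v"
  have scale: "X *v (c *\<^sub>R x) = c *\<^sub>R (X *v x)" for c x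
    by (rule linear_simps(5)[OF lin])
  have bound: "(X *v x) \<bullet> x \<le> \<mu> * (x \<bullet> x)" for x
  proof (cases "x = 0")
    case False
    have "(X *v ((1 / norm x) *\<^sub>R x)) \<bullet> ((1 / norm x) *\<^sub>R x) \<le> \<mu>"
      unfolding \<mu>_def by (rule v(2)) (use False in simp)
    then show ?thesis using False
      by (simp add: scale field_simps dot_square_norm power2_eq_square)
  qed simp
  define y where "y = \<mu> *\<^sub>R v - X *v v"
  have crit: "2 * t * (y \<bullet> y) + t\<^sup>2 * (\<mu> * (y \<bullet> y) - (X *v y) \<bullet> y) \<ge> 0" for t
  proof -
    have *: "(X *v y) \<bullet> v = y \<bullet> (X *v v)" by (rule hermitian_inner[OF assms])
    have **: "v \<bullet> v = 1" using v(1) by (simp add: dot_square_norm)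
    have q1: "(X *v (v + t *\<^sub>R y)) \<bullet> (v + t *\<^sub>R y)
        = \<mu> + 2 * t * (y \<bullet> (X *v v)) + t\<^sup>2 * ((X *v y) \<bullet> y)"
      by (simp add: matrix_vector_right_distrib scale inner_add_left inner_add_right * \<mu>_def
          power2_eq_square inner_commute[of "X *v v" y] distrib_left)
    have q2: "(v + t *\<^sub>R y) \<bullet> (v + t *\<^sub>R y) = 1 + 2 * t * (y \<bullet> v) + t\<^sup>2 * (y \<bullet> y)"
      by (simp add: inner_add_left inner_add_right ** power2_eq_square inner_commute[of v y]
          distrib_left)
    have "y \<bullet> y = y \<bullet> (\<mu> *\<^sub>R v - X *v v)" unfolding y_def ..
    then have q3: "y \<bullet> (X *v v) = \<mu> * (y \<bullet> v) - y \<bullet> y"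
      unfolding inner_diff_right inner_scaleR_right by linarith
    show ?thesis using bound[of "v + t *\<^sub>R y", unfolded q1 q2 q3] by (simp add: algebra_simps)
  qed
  define c where "c = \<mu> * (y \<bullet> y) - (X *v y) \<bullet> y"
  have "y \<bullet> y = 0"
  proof (rule ccontr)
    assume "y \<bullet> y \<noteq> 0"
    then have pos: "y \<bullet> y > 0" by simp
    have c: "c \<ge> 0" unfolding c_def using bound[of y] by simp
    \<comment> \<open>A negative step so short that the linear term in \<open>crit\<close> dominates the quadratic one.\<close>
    define t where "t = - (y \<bullet> y) / (c + 1)"
    have "t < 0" unfolding t_def using pos c by (simp add: divide_neg_pos)
    moreover have "t * (c + 1) = - (y \<bullet> y)" unfolding t_def using c by simp
    with \<open>t < 0\<close> have "t * c \<ge> - (y \<bullet> y)" by (simp add: distrib_left)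
    then have "2 * (y \<bullet> y) + t * c > 0" using pos by linarith
    ultimately have "t * (2 * (y \<bullet> y) + t * c) < 0" by (rule mult_neg_pos)
    moreover have "2 * t * (y \<bullet> y) + t\<^sup>2 * c = t * (2 * (y \<bullet> y) + t * c)"
      by (simp add: distrib_left power2_eq_square)
    ultimately show False using crit[of t] unfolding c_def by linarith
  qed
  then have eig: "X *v v = complex_of_real \<mu> *s v" by (simp add: y_def smult_of_real)
  have "v \<noteq> 0" using v(1) by auto
  from that[OF this eig bound] show ?thesis .
qed

lemma hermitian_inner_le_max_eigval:
  assumes "hermitian X"
  shows "(X *v x) \<bullet> x \<le> max_eigval X * (x \<bullet> x)"
    and "\<exists>v. v \<noteq> 0 \<and> X *v v = complex_of_real (max_eigval X) *s v"
proof -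
  let ?E = "{r. \<exists>v. v \<noteq> 0 \<and> X *v v = complex_of_real r *s v}"
  obtain \<mu> v where \<mu>: "v \<noteq> 0" "X *v v = complex_of_real \<mu> *s v"
    "\<And>x. (X *v x) \<bullet> x \<le> \<mu> * (x \<bullet> x)"
    using hermitian_rayleigh_eigenvalue[OF assms] by blast
  then have "\<mu> \<in> ?E" by blast
  moreover have fin: "finite ?E" by (rule finite_hermitian_eigenvalues[OF assms])
  ultimately have "\<mu> \<le> max_eigval X" "max_eigval X \<in> ?E"
    unfolding max_eigval_def using Max_ge[of ?E \<mu>] Max_in[of ?E] by blast+
  then show "\<exists>v. v \<noteq> 0 \<and> X *v v = complex_of_real (max_eigval X) *s v" by blast
  have "\<mu> * (x \<bullet> x) \<le> max_eigval X * (x \<bullet> x)"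
    using \<open>\<mu> \<le> max_eigval X\<close> by (simp add: mult_right_mono)
  with \<mu>(3)[of x] show "(X *v x) \<bullet> x \<le> max_eigval X * (x \<bullet> x)" by linarith
qed

text \<open>The longest semi-axis of the ellipsoid \<open>(S\<^sup>-\<^sup>1 w, w) \<le> 1\<close> has squared length \<open>\<lambda>(S)\<close>.  The bound follows
  from \<open>young_pos_def\<close> with \<open>y = w / \<lambda>(S)\<close>.\<close>

lemma norm_le_max_eigval:
  assumes S: "pos_def S" and w: "(matrix_inv S *v w) \<bullet> w \<le> 1"
  shows "w \<bullet> w \<le> max_eigval S"
proof -
  let ?m = "max_eigval S"
  obtain v where v: "v \<noteq> 0 \<and> S *v v = complex_of_real ?m *s v"
    using hermitian_inner_le_max_eigval(2)[OF pos_def_hermitian[OF S]] by (rule exE)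
  have "(S *v v) \<bullet> v > 0" using S v by (metis pos_def_def Re_cinner)
  then have "?m * (v \<bullet> v) > 0" by (simp add: v smult_of_real)
  then have m: "?m > 0" by (rule zero_less_mult_pos2) (use v in simp)
  have "2 * (w \<bullet> ((1 / ?m) *\<^sub>R w)) \<le>
      (S *v ((1 / ?m) *\<^sub>R w)) \<bullet> ((1 / ?m) *\<^sub>R w) + (matrix_inv S *v w) \<bullet> w"
    by (rule young_pos_def[OF S])
  also have "\<dots> \<le> ?m * (((1 / ?m) *\<^sub>R w) \<bullet> ((1 / ?m) *\<^sub>R w)) + 1"
    by (intro add_mono hermitian_inner_le_max_eigval(1) pos_def_hermitian S w)
  finally show ?thesis using m by (simp add: field_simps)
qed


section \<open>Modes and the matrix \<open>\<Psi>\<close>\<close>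

lemma pos_less_card: "pos (i :: 'n :: {finite, linorder}) < CARD('n)"
  unfolding pos_def by (rule psubset_card_mono) auto

lemma pos_strict_mono: "(i :: 'n :: {finite, linorder}) < j \<Longrightarrow> pos i < pos j"
  unfolding pos_def by (rule psubset_card_mono) (auto intro: order.strict_trans)

lemma pos_eq_iff [simp]: "pos i = pos j \<longleftrightarrow> (i :: 'n :: {finite, linorder}) = j"
  by (metis less_irrefl linorder_neqE pos_strict_mono)

lemma pos_surj:
  assumes "r < CARD('n)"
  obtains i :: "'n :: {finite, linorder}" where "pos i = r"
proof -
  have "inj (pos :: 'n \<Rightarrow> nat)" by (simp add: inj_on_def)
  then have "card (range (pos :: 'n \<Rightarrow> nat)) = card {..<CARD('n)}" by (simp add: card_image)
  then have "range (pos :: 'n \<Rightarrow> nat) = {..<CARD('n)}"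
    by (intro card_subset_eq) (auto simp: pos_less_card)
  then have "r \<in> range (pos :: 'n \<Rightarrow> nat)" using assms by simp
  then obtain i :: 'n where "r = pos i" by blast
  then show thesis using that by simp
qed

text \<open>Counting positions from the end instead of the start corresponds to negating modes, see
  \<open>mode_reflect\<close>.\<close>

definition reflect :: "'n :: {finite, linorder} \<Rightarrow> 'n" where
  "reflect i = (THE j. pos j = CARD('n) - 1 - pos i)"

lemma pos_reflect: "pos (reflect i) = CARD('n) - 1 - pos i"
  for i :: "'n :: {finite, linorder}"
proof -
  have "CARD('n) - 1 - pos i < CARD('n)" by (simp add: less_imp_diff_less)
  then obtain j :: 'n where "pos j = CARD('n) - 1 - pos i" by (rule pos_surj)
  then show ?thesis
    unfolding reflect_def by (metis (mono_tags, lifting) pos_eq_iff the_equality)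
qed

lemma pos_reflect_add: "pos (reflect i) + pos i + 1 = CARD('n)"
  for i :: "'n :: {finite, linorder}"
  using pos_reflect[of i] pos_less_card[of i] by linarith

lemma reflect_reflect [simp]: "reflect (reflect i) = i"
  using pos_reflect_add[of i] pos_reflect_add[of "reflect i"]
  by (subst pos_eq_iff[symmetric]) linarith

text \<open>For the position \<open>a (N2 + 1) + b\<close> the reflected position is \<open>(N1 - a) (N2 + 1) + (N2 - b)\<close>, and
  both coordinates of a mode are centred at the middle because \<open>N1\<close> and \<open>N2\<close> are even.\<close>

lemma mode_reflect:
  fixes i :: "'n :: {finite, linorder}"
  assumes "CARD('n) = (N1 + 1) * (N2 + 1)" and "even N1" "even N2"
  shows "mode N1 N2 (reflect i) = - mode N1 N2 i"
proof -
  define a b where "a = pos i div (N2 + 1)" and "b = pos i mod (N2 + 1)"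
  have pos: "pos i = a * (N2 + 1) + b" unfolding a_def b_def by (rule div_mult_mod_eq[symmetric])
  have b: "b \<le> N2" unfolding b_def by (simp add: less_Suc_eq_le[symmetric])
  have "a < N1 + 1"
    unfolding a_def using pos_less_card[of i] assms(1) by (metis less_mult_imp_div_less)
  then have a: "a \<le> N1" by simp
  obtain a' b' where ab': "N1 = a + a'" "N2 = b + b'" using a b by (metis le_add_diff_inverse)
  have "pos (reflect i) + (a * (N2 + 1) + b) + 1 = (a + a' + 1) * (N2 + 1)"
    using pos_reflect_add[of i] pos assms(1) ab'(1) by simp
  also have "\<dots> = a' * (N2 + 1) + b' + (a * (N2 + 1) + b) + 1"
    using ab'(2) by (simp add: algebra_simps)
  finally have eq: "pos (reflect i) = a' * (N2 + 1) + b'" by simp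
  have b': "b' < N2 + 1" using ab' by simp
  have "pos (reflect i) div (N2 + 1) = a'"
    unfolding eq using b' by (metis add.commute add_0_left div_less div_mult_self1 add_is_0 one_neq_zero)
  moreover have "pos (reflect i) mod (N2 + 1) = b'"
    unfolding eq using b' by (metis mod_less mod_mult_self3)
  moreover have "int N1 = 2 * int (N1 div 2)" "int N2 = 2 * int (N2 div 2)"
    using assms(2,3) by auto
  ultimately show ?thesis
    unfolding mode_def a_def[symmetric] b_def[symmetric] using ab' by simp
qed

text \<open>The middle position is its own reflection, so its mode is its own negative.\<close>

lemma mode_middle:
  fixes i :: "'n :: {finite, linorder}"
  assumes "CARD('n) = (N1 + 1) * (N2 + 1)" and "even N1" "even N2"
    and "pos i = (CARD('n) - 1) div 2"
  shows "mode N1 N2 i = (0, 0)"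
proof -
  have "odd (CARD('n))" using assms(1-3) by simp
  then obtain m where "CARD('n) = 2 * m + 1" by (rule oddE)
  then have "pos (reflect i) = pos i" using pos_reflect[of i] assms(4) by simp
  then have "mode N1 N2 i = - mode N1 N2 i" using mode_reflect[OF assms(1-3), of i] by simp
  then show ?thesis by (cases "mode N1 N2 i") simp
qed

lemma Psi_entry:
  fixes i j :: "'n :: {finite, linorder}"
  assumes "CARD('n) = 2 * n + 1"
  shows "(Psi :: ('n, 'n) cmat) $ i $ j = complex_of_real (1 / sqrt 2) *
    (if pos i = n then 0
     else if j = i then (if pos i < n then 1 else - 1)
     else if j = reflect i then 1 else 0)"
proof -
  have n: "(CARD('n) - 1) div 2 = n" using assms by simp
  have *: "pos (reflect i) + pos i = 2 * n" using pos_reflect_add[of i] assms by simp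
  have eq: "j = i \<longleftrightarrow> pos j = pos i" "j = reflect i \<longleftrightarrow> pos j + pos i = 2 * n"
    using * by (simp, metis add_right_cancel pos_eq_iff)
  show ?thesis
    unfolding Psi_def Let_def n eq by auto
qed

lemma adj_Psi: 
  assumes "CARD('n) = 2 * n + 1"
  shows "adj (Psi :: ('n :: {finite, linorder}, 'n) cmat) = Psi"
proof -
  have "pos (reflect i) + pos i = 2 * n" for i :: 'n using pos_reflect_add[of i] assms by simp
  then have eq: "j = reflect i \<longleftrightarrow> pos j + pos i = 2 * n" for i j :: 'n
    by (metis add_right_cancel pos_eq_iff)
  show ?thesis
    unfolding adj_def vec_eq_iff Psi_entry[OF assms] eq
    by (auto simp flip: pos_eq_iff)
qed

lemma Psi_mult:
  fixes x :: "('n :: {finite, linorder}) cvec"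
  assumes "CARD('n) = 2 * n + 1" and "pos i \<noteq> n"
  shows "(Psi *v x) $ i = complex_of_real (1 / sqrt 2) *
    ((if pos i < n then 1 else - 1) * x $ i + x $ reflect i)"
proof -
  have ne: "reflect i \<noteq> i"
    using assms pos_reflect_add[of i] by auto
  let ?c = "complex_of_real (1 / sqrt 2)" and ?s = "if pos i < n then 1 else - 1 :: complex"
  have "(Psi *v x) $ i = (\<Sum>j\<in>UNIV. (if j = i then ?c * ?s * x $ j else 0) +
      (if j = reflect i then ?c * x $ j else 0))"
    unfolding matrix_vector_mult_def vec_lambda_beta Psi_entry[OF assms(1)]
    using assms(2) ne by (intro sum.cong) auto
  also have "\<dots> = ?c * (?s * x $ i + x $ reflect i)"
    unfolding sum.distrib by (simp add: distrib_left mult.assoc)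
  finally show ?thesis .
qed

text \<open>On each pair \<open>(x\<^sub>i, x\<^sub>-\<^sub>i)\<close> of opposite coordinates \<open>\<Psi>\<close> acts as the symmetric orthogonal matrix
  \<open>(1, 1; 1, -1) / \<surd>2\<close>, whose square is the identity; it annihilates the middle coordinate.\<close>

lemma Psi_Psi:
  fixes x :: "('n :: {finite, linorder}) cvec"
  assumes "CARD('n) = 2 * n + 1" and "pos i \<noteq> n"
  shows "(Psi *v (Psi *v x)) $ i = x $ i"
proof -
  have *: "pos (reflect i) + pos i = 2 * n" using pos_reflect_add[of i] assms(1) by simp
  then have ne: "pos (reflect i) \<noteq> n" and lt: "pos (reflect i) < n \<longleftrightarrow> \<not> pos i < n"
    using assms(2) by auto
  have half: "complex_of_real (1 / sqrt 2) * complex_of_real (1 / sqrt 2) = 1 / 2"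
    by (simp flip: of_real_mult)
  have "(Psi *v (Psi *v x)) $ i =
      (complex_of_real (1 / sqrt 2) * complex_of_real (1 / sqrt 2)) * (2 * x $ i)"
    unfolding Psi_mult[OF assms] Psi_mult[OF assms(1) ne] lt reflect_reflect
    by (simp add: algebra_simps del: of_real_divide)
  then show ?thesis unfolding half by simp
qed


section \<open>The convection matrix\<close>

text \<open>Up to sign, this is the weight with which the vorticity mode \<open>k\<close>, through the velocity that it induces,
  transports the mode \<open>j\<close>.\<close>

definition interaction_coeff :: "real \<Rightarrow> real \<Rightarrow> int \<times> int \<Rightarrow> int \<times> int \<Rightarrow> real" where
  "interaction_coeff Lx Ly k j =
     of_int (fst k * snd j - snd k * fst j) * Lx * Ly /
     ((of_int (fst k))\<^sup>2 * Ly\<^sup>2 + (of_int (snd k))\<^sup>2 * Lx\<^sup>2)"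

lemma B_mat_entry:
  "B_mat N1 N2 Lx Ly w $ i $ j =
     - (\<Sum>k | mode N1 N2 k \<noteq> (0, 0).
          w $ k * complex_of_real (interaction_coeff Lx Ly (mode N1 N2 k) (mode N1 N2 j)) *
          (if mode N1 N2 k + mode N1 N2 j = mode N1 N2 i then 1 else 0))"
  by (simp add: B_mat_def Let_def case_prod_unfold interaction_coeff_def prod_eq_iff)

lemma B_mat_add: "B_mat N1 N2 Lx Ly (v + w) = B_mat N1 N2 Lx Ly v + B_mat N1 N2 Lx Ly w"
  by (simp add: vec_eq_iff B_mat_entry distrib_right sum.distrib)

lemma B_mat_diff: "B_mat N1 N2 Lx Ly (v - w) = B_mat N1 N2 Lx Ly v - B_mat N1 N2 Lx Ly w"
  using B_mat_add[of N1 N2 Lx Ly "v - w" w] by (simp add: algebra_simps)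

lemma B_mat_scale: "B_mat N1 N2 Lx Ly (c *s w) *v x = c *s (B_mat N1 N2 Lx Ly w *v x)"
  by (simp add: vec_eq_iff B_mat_entry matrix_vector_mult_def sum_distrib_left sum_distrib_right
      sum_negf mult.assoc)

lemma B_mat_sum:
  "B_mat N1 N2 Lx Ly (\<Sum>j\<in>J. c j *s v j) *v x = (\<Sum>j\<in>J. c j *s (B_mat N1 N2 Lx Ly (v j) *v x))"
proof (induction J rule: infinite_finite_induct)
  case (insert j J)
  then show ?case
    by (simp add: B_mat_add B_mat_scale matrix_vector_mult_add_rdistrib)
qed (simp_all add: vec_eq_iff B_mat_entry matrix_vector_mult_def)

text \<open>By linearity of \<open>B\<close> the product is \<open>B(\<Psi> \<Psi>\<^sup>\<star> x) w\<close>, and \<open>\<Psi> \<Psi>\<^sup>\<star> x\<close> differs from \<open>x\<close> only in the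
  coordinate of the mode \<open>(0, 0)\<close>, on which \<open>B\<close> does not depend.\<close>

lemma B1_mat_mult:
  fixes w x :: "('n :: {finite, linorder}) cvec"
  assumes card: "CARD('n) = (N1 + 1) * (N2 + 1)" and even: "even N1" "even N2"
  shows "B1_mat N1 N2 Lx Ly w *v x = B_mat N1 N2 Lx Ly x *v w"
proof -
  let ?B = "B_mat N1 N2 Lx Ly" and ?Psi = "Psi :: ('n, 'n) cmat"
  define n where "n = (CARD('n) - 1) div 2"
  have n: "CARD('n) = 2 * n + 1" using card even unfolding n_def by simp
  define y where "y = ?Psi *v x"
  let ?M = "\<chi> i j. (?B (?Psi *v axis j 1) *v w) $ i"
  have "B1_mat N1 N2 Lx Ly w *v x = ?M *v y"
    unfolding B1_mat_def y_def adj_Psi[OF n] by (simp add: matrix_vector_mul_assoc)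
  also have "\<dots> = (\<Sum>j\<in>UNIV. y $ j *s (?B (?Psi *v axis j 1) *v w))"
    unfolding matrix_mult_sum[of ?M y]
    by (intro sum.cong refl arg_cong2[of _ _ _ _ "(*s)"]) (simp add: column_def vec_eq_iff)
  also have "\<dots> = ?B (\<Sum>j\<in>UNIV. y $ j *s (?Psi *v axis j 1)) *v w"
    by (simp add: B_mat_sum)
  also have "(\<Sum>j\<in>UNIV. y $ j *s (?Psi *v axis j 1)) = ?Psi *v y"
  proof -
    have "?Psi *v axis j 1 = column j ?Psi" for j
      by (simp add: vec_eq_iff column_def matrix_vector_mult_def axis_def if_distrib[of "\<lambda>x. _ * x"]
          cong: if_cong)
    then show ?thesis unfolding matrix_mult_sum[of ?Psi y] by simp
  qed
  also have "?B (?Psi *v y) = ?B x"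
  proof -
    have "(?Psi *v y) $ k = x $ k" if "mode N1 N2 k \<noteq> (0, 0)" for k
      using Psi_Psi[OF n] mode_middle[OF card even, of k] that unfolding y_def n_def by blast
    then show ?thesis by (simp add: vec_eq_iff B_mat_entry)
  qed
  finally show ?thesis .
qed

text \<open>The numerator \<open>k\<^sub>1 j\<^sub>2 - k\<^sub>2 j\<^sub>1\<close> of the coefficient is an alternating form and the denominator is even
  in \<open>k\<close>.  Hence for \<open>k + j = i\<close> the coefficient of \<open>(k, j)\<close> equals that of \<open>(k, i)\<close>, which is
  the negative of that of \<open>(- k, i)\<close>.  Reality of \<open>w\<close> matches the coordinates at \<open>k\<close> and \<open>- k\<close>.\<close>

lemma B_mat_skew:
  fixes w :: "('n :: {finite, linorder}) cvec"
  assumes card: "CARD('n) = (N1 + 1) * (N2 + 1)" and even: "even N1" "even N2"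
    and real: "\<And>k. w $ reflect k = cnj (w $ k)"
  shows "adj (B_mat N1 N2 Lx Ly w) = - B_mat N1 N2 Lx Ly w"
proof -
  let ?m = "mode N1 N2 :: 'n \<Rightarrow> int \<times> int" and ?c = "interaction_coeff Lx Ly"
  note refl = mode_reflect[OF card even]
  have "adj (B_mat N1 N2 Lx Ly w) $ i $ j = - B_mat N1 N2 Lx Ly w $ i $ j" for i j
  proof -
    have "(\<Sum>k | ?m k \<noteq> (0, 0). cnj (w $ k) * complex_of_real (?c (?m k) (?m i)) *
            (if ?m k + ?m i = ?m j then 1 else 0)) =
          - (\<Sum>k | ?m k \<noteq> (0, 0). w $ k * complex_of_real (?c (?m k) (?m j)) *
            (if ?m k + ?m j = ?m i then 1 else 0))"
      unfolding sum_negf[symmetric]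
    proof (rule sum.reindex_bij_witness[where i = reflect and j = reflect])
      fix k
      have c: "?c (- ?m k) (?m j) = - ?c (?m k) (?m i)" if "- ?m k + ?m j = ?m i"
        unfolding interaction_coeff_def that[symmetric]
        by (simp add: algebra_simps minus_divide_left)
      have eq: "- ?m k + ?m j = ?m i \<longleftrightarrow> ?m k + ?m i = ?m j" by (auto simp: algebra_simps)
      show "- (w $ reflect k * complex_of_real (?c (?m (reflect k)) (?m j)) *
          (if ?m (reflect k) + ?m j = ?m i then 1 else 0)) =
        cnj (w $ k) * complex_of_real (?c (?m k) (?m i)) * (if ?m k + ?m i = ?m j then 1 else 0)"
        using c unfolding refl eq real by auto
    qed (auto simp: refl prod_eq_iff)
    then show ?thesis
      by (simp add: adj_def B_mat_entry if_distrib[of cnj] cong: if_cong)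
  qed
  then show ?thesis by (simp add: vec_eq_iff)
qed

lemma B_mat_inner_self:
  fixes w :: "('n :: {finite, linorder}) cvec"
  assumes "CARD('n) = (N1 + 1) * (N2 + 1)" "even N1" "even N2"
    and "\<And>k. w $ reflect k = cnj (w $ k)"
  shows "(B_mat N1 N2 Lx Ly w *v x) \<bullet> x = 0"
proof -
  have "(B_mat N1 N2 Lx Ly w *v x) \<bullet> x = x \<bullet> (- B_mat N1 N2 Lx Ly w *v x)"
    unfolding inner_adj B_mat_skew[OF assms] ..
  also have "- B_mat N1 N2 Lx Ly w *v x = - (B_mat N1 N2 Lx Ly w *v x)"
    by (simp add: vec_eq_iff matrix_vector_mult_def sum_negf)
  also have "x \<bullet> - (B_mat N1 N2 Lx Ly w *v x) = - ((B_mat N1 N2 Lx Ly w *v x) \<bullet> x)"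
    by (simp add: inner_commute)
  finally show ?thesis by simp
qed


section \<open>The estimation error\<close>

text \<open>Young's inequality is applied to the pairs \<open>(f, D\<^sup>\<star> e)\<close> and \<open>(\<eta>, - F\<^sup>\<star> H P e)\<close>.  The resulting forms in
  \<open>e\<close> are \<open>(D Q D\<^sup>\<star> e, e)\<close> and \<open>(P H\<^sup>\<star> F R F\<^sup>\<star> H P e, e)\<close>, exactly those that the matrix inequality
  absorbs.\<close>

lemma error_energy_bound:
  fixes A B G P Q D :: "('n :: finite, 'n) cmat" and H :: "('m :: finite, 'n) cmat"
    and F R :: "('m, 'm) cmat"
  assumes P: "hermitian P" and Q: "pos_def Q" and R: "pos_def R"
    and noise: "(matrix_inv Q *v f) \<bullet> f + (matrix_inv R *v \<eta>) \<bullet> \<eta> \<le> 1"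
    and B: "(B *v e) \<bullet> e = 0"
    and A: "(A *v e) \<bullet> e \<le> - a * (e \<bullet> e)"
    and ineq: "herm_less (G + adj G + D ** Q ** adj D - P ** adj H ** H - adj H ** H ** P
           + P ** adj H ** F ** R ** adj F ** H ** P) (mat (complex_of_real (- q)))"
  shows "2 * ((B *v e + G *v e + A *v e + D *v f - (P ** adj H) *v (H *v e + F *v \<eta>)) \<bullet> e)
         \<le> 1 - (2 * a + q) * (e \<bullet> e)"
proof -
  define g where "g = adj D *v e"
  define k where "k = - (adj F *v (H *v (P *v e)))"
  let ?X = "G + adj G + D ** Q ** adj D - P ** adj H ** H - adj H ** H ** P
           + P ** adj H ** F ** R ** adj F ** H ** P"
  have adjP: "adj P = P" using P by (simp add: hermitian_def)
  have neg: "X *v (- x) = - (X *v x)" for X :: "('m, 'm) cmat" and x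
    using matrix_vector_mult_diff_distrib[of X 0 x] by simp
  have "(?X *v e) \<bullet> e \<le> - q * (e \<bullet> e)"
  proof (cases "e = 0")
    case False
    have "((mat (complex_of_real (- q)) - ?X) *v e) \<bullet> e > 0"
      using ineq False unfolding herm_less_def pos_def_def Re_cinner by blast
    moreover have "mat (complex_of_real (- q)) *v e = complex_of_real (- q) *s e"
      by (simp add: vec_eq_iff matrix_vector_mult_def mat_def if_distrib[of "\<lambda>x. x * _"]
          cong: if_cong)
    then have "mat (complex_of_real (- q)) *v e = (- q) *\<^sub>R e"
      unfolding smult_of_real .
    ultimately show ?thesis
      by (simp add: matrix_vector_mult_diff_rdistrib inner_diff_left)
  qed simp
  moreover have "(?X *v e) \<bullet> e = 2 * ((G *v e) \<bullet> e) + (Q *v g) \<bullet> g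
      - 2 * (((P ** adj H) *v (H *v e)) \<bullet> e) + (R *v k) \<bullet> k"
  proof -
    have 1: "(adj G *v e) \<bullet> e = (G *v e) \<bullet> e"
      using inner_adj[of G e e] by (simp add: inner_commute)
    have 2: "((D ** Q ** adj D) *v e) \<bullet> e = (Q *v g) \<bullet> g"
      by (simp add: matrix_vector_mul_assoc[symmetric] g_def inner_adj[of D])
    have 3: "((adj H ** H ** P) *v e) \<bullet> e = ((P ** adj H) *v (H *v e)) \<bullet> e"
      using inner_adj[of "adj H ** H ** P" e e]
      by (simp add: adj_mult adjP matrix_vector_mul_assoc[symmetric] inner_commute)
    have 4: "((P ** adj H ** F ** R ** adj F ** H ** P) *v e) \<bullet> e = (R *v k) \<bullet> k"
      by (simp add: matrix_vector_mul_assoc[symmetric] inner_adj[of P] inner_adj[of "adj H"]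
          inner_adj[of F] adjP k_def neg)
    show ?thesis
      unfolding matrix_vector_mult_add_rdistrib matrix_vector_mult_diff_rdistrib
        inner_add_left inner_diff_left 1 2 3 4
      by (simp add: matrix_vector_mul_assoc)
  qed
  moreover have "(D *v f) \<bullet> e = f \<bullet> g"
    by (simp add: inner_adj g_def)
  moreover have "((P ** adj H) *v (F *v \<eta>)) \<bullet> e = - (\<eta> \<bullet> k)"
    by (simp add: matrix_vector_mul_assoc[symmetric] inner_adj[of P] inner_adj[of "adj H"]
          inner_adj[of F] adjP k_def)
  moreover have "2 * (f \<bullet> g) \<le> (Q *v g) \<bullet> g + (matrix_inv Q *v f) \<bullet> f"
    "2 * (\<eta> \<bullet> k) \<le> (R *v k) \<bullet> k + (matrix_inv R *v \<eta>) \<bullet> \<eta>"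
    using young_pos_def Q R by blast+
  ultimately show ?thesis
    using noise A B
    by (simp add: inner_add_left inner_diff_left matrix_vector_right_distrib algebra_simps)
qed

lemma A_mat_hermitian: "hermitian (A_mat N1 N2 Lx Ly \<nu>)"
  by (auto simp: hermitian_def adj_def A_mat_def vec_eq_iff)

lemma A_mat_max_eigval_nonpos:
  assumes "\<nu> > 0"
  shows "max_eigval (A_mat N1 N2 Lx Ly \<nu> :: ('n :: {finite, linorder}, 'n) cmat) \<le> 0"
proof -
  let ?A = "A_mat N1 N2 Lx Ly \<nu> :: ('n, 'n) cmat"
  obtain v where v: "v \<noteq> 0 \<and> ?A *v v = complex_of_real (max_eigval ?A) *s v"
    using hermitian_inner_le_max_eigval(2)[OF A_mat_hermitian] by (rule exE)
  then obtain i where i: "v $ i \<noteq> 0" by (auto simp: vec_eq_iff)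
  have "(?A *v v) $ i = complex_of_real (- \<nu> * lap_eig Lx Ly (mode N1 N2 i)) * v $ i"
    by (simp add: A_mat_def matrix_vector_mult_def if_distrib[of "\<lambda>x. x * _"] cong: if_cong)
  with v i have "max_eigval ?A = - \<nu> * lap_eig Lx Ly (mode N1 N2 i)"
    by (metis mult_right_cancel of_real_eq_iff vector_smult_component)
  moreover have "lap_eig Lx Ly (mode N1 N2 i) \<ge> 0" unfolding lap_eig_def by simp
  ultimately show ?thesis using assms by simp
qed

theorem theorem4p1:
  fixes N1 N2 :: nat and Lx Ly \<nu> q :: real
    and T :: "(real \<times> real \<Rightarrow> complex) \<Rightarrow> (real \<times> real \<Rightarrow> complex)"
    and h :: "'m :: finite \<Rightarrow> real \<times> real \<Rightarrow> complex"
    and A D S :: "('n, 'n :: {finite, linorder}) cmat"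
    and H :: "('m, 'n) cmat"
    and F :: "('m, 'm) cmat"
    and Q :: "real \<Rightarrow> ('n, 'n) cmat"
    and R :: "real \<Rightarrow> ('m, 'm) cmat"
    and P :: "real \<Rightarrow> 'n cvec \<Rightarrow> ('n, 'n) cmat"
    and E :: "('n cvec \<times> (real \<Rightarrow> 'n cvec) \<times> (real \<Rightarrow> 'm cvec)) set"
    and \<omega> \<omega>hat :: "'n cvec \<times> (real \<Rightarrow> 'n cvec) \<times> (real \<Rightarrow> 'm cvec)
                    \<Rightarrow> real \<Rightarrow> 'n cvec"
  assumes N1: "even N1" "N1 > 0" and N2: "even N2" "N2 > 0"
    and card: "CARD('n) = (N1 + 1) * (N2 + 1)"
    and domain: "Lx > 0" "Ly > 0" and nu: "\<nu> > 0" and q: "q > 0"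
    and T: "bounded_L2_operator Lx Ly T"
    and h: "\<And>k. h k \<in> L2 Lx Ly"
    and A: "A = A_mat N1 N2 Lx Ly \<nu>"
    and D: "D = D_mat N1 N2 Lx Ly T"
    and H: "H = H_mat N1 N2 Lx Ly h"
    and S: "pos_def S"
    and Q: "\<And>t. t \<ge> 0 \<Longrightarrow> pos_def (Q t)"
    and R: "\<And>t. t \<ge> 0 \<Longrightarrow> pos_def (R t)"
    and E: "E = uncertainty_set N1 N2 Lx Ly \<nu> D S Q R"
    and P: "\<And>t x. t \<ge> 0 \<Longrightarrow> hermitian (P t x)"
    and state: "\<And>w0 f \<eta>. (w0, f, \<eta>) \<in> E \<Longrightarrow>
        state_solution N1 N2 Lx Ly \<nu> D w0 f (\<omega> (w0, f, \<eta>))"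
    and filter: "\<And>w0 f \<eta>. (w0, f, \<eta>) \<in> E \<Longrightarrow>
        filter_solution N1 N2 Lx Ly \<nu> H P
          (\<lambda>t. H *v \<omega> (w0, f, \<eta>) t + F *v \<eta> t) (\<omega>hat (w0, f, \<eta>))"
    and ineq: "\<And>w0 f \<eta> t x Pt. (w0, f, \<eta>) \<in> E \<Longrightarrow> t \<ge> 0 \<Longrightarrow>
        x = \<omega>hat (w0, f, \<eta>) t \<Longrightarrow> Pt = P t x \<Longrightarrow>
        herm_less
          (B1_mat N1 N2 Lx Ly x + adj (B1_mat N1 N2 Lx Ly x) + D ** Q t ** adj D
           - Pt ** adj H ** H - adj H ** H ** Pt
           + Pt ** adj H ** F ** R t ** adj F ** H ** Pt)
          (mat (complex_of_real (- q)))"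
  shows "\<forall>t\<ge>0.
    (SUP e\<in>E. ereal (Re (cinner (\<omega> e t - \<omega>hat e t) (\<omega> e t - \<omega>hat e t))))
      \<le> ereal (1 / (2 * \<bar>max_eigval A\<bar> + q)
               + (max_eigval S - 1 / (2 * \<bar>max_eigval A\<bar> + q))
                 * exp (- (2 * \<bar>max_eigval A\<bar> + q) * t))"
proof (intro allI impI, rule SUP_least)
  fix t :: real and d assume "t \<ge> 0" and "d \<in> E"
  obtain w0 f \<eta> where d: "d = (w0, f, \<eta>)" by (cases d)
  have dE: "(w0, f, \<eta>) \<in> E" using \<open>d \<in> E\<close> d by simp
  define w wh where "w = \<omega> d" and "wh = \<omega>hat d"
  define e where "e s = w s - wh s" for s
  define a where "a = \<bar>max_eigval A\<bar>"
  have w: "state_solution N1 N2 Lx Ly \<nu> D w0 f w"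
    using state[OF dE] unfolding w_def d .
  have wh: "filter_solution N1 N2 Lx Ly \<nu> H P (\<lambda>s. H *v w s + F *v \<eta> s) wh"
    using filter[OF dE] unfolding w_def wh_def d .
  have init: "Re (cinner (matrix_inv S *v w0) w0) \<le> 1"
    and noise: "\<And>s. s \<ge> 0 \<Longrightarrow> Re (cinner (matrix_inv (Q s) *v f s) (f s)) +
             Re (cinner (matrix_inv (R s) *v \<eta> s) (\<eta> s)) \<le> 1"
    using dE unfolding E uncertainty_set_def by auto
  \<comment> \<open>Reality is known for some solution of the state equation; uniqueness transfers it to \<open>\<omega>\<close>.\<close>
  obtain w' where w': "\<And>v. state_solution N1 N2 Lx Ly \<nu> D w0 f v \<Longrightarrow> \<forall>s\<ge>0. v s = w' s"
    "real_zero_mean N1 N2 w'"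
    using dE unfolding E uncertainty_set_def by auto
  have real: "w s $ reflect k = cnj (w s $ k)" if "s \<ge> 0" for s k
    using w'(2) w'(1)[OF w] that mode_reflect[OF card N1(1) N2(1), of k]
    unfolding real_zero_mean_def by simp
  have "max_eigval A \<le> 0" unfolding A by (rule A_mat_max_eigval_nonpos[OF nu])
  then have A_le: "(A *v x) \<bullet> x \<le> - a * (x \<bullet> x)" for x
    using hermitian_inner_le_max_eigval(1)[OF A_mat_hermitian, of N1 N2 Lx Ly \<nu> x]
    unfolding A a_def by simp
  have "e t \<bullet> e t \<le> 1 / (2 * a + q) + (e 0 \<bullet> e 0 - 1 / (2 * a + q)) * exp (- (2 * a + q) * t)"
  proof (cases "t = 0")
    case False
    then have "t > 0" using \<open>t \<ge> 0\<close> by simp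
    show ?thesis
    proof (rule abs_cont_gronwall)
      show "2 * a + q > 0" using q by (simp add: a_def add_nonneg_pos)
      show "abs_cont_on 0 t e"
        unfolding e_def using w wh \<open>t > 0\<close>
        by (intro abs_cont_on_diff) (auto simp: state_solution_def filter_solution_def ode_solution_def)
      let ?w' = "\<lambda>s. B_mat N1 N2 Lx Ly (w s) *v w s + A *v w s + D *v f s"
      let ?wh' = "\<lambda>s. B_mat N1 N2 Lx Ly (wh s) *v wh s + A *v wh s +
        (P s (wh s) ** adj H) *v (H *v w s + F *v \<eta> s - H *v wh s)"
      have "AE s in lebesgue. s \<in> {0..} \<longrightarrow> (w has_vector_derivative ?w' s) (at s within {0..})"
        using w unfolding state_solution_def ode_solution_def A
        by (simp add: AE_restrict_space_iff)
      moreover have "AE s in lebesgue. s \<in> {0..} \<longrightarrow>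
          (wh has_vector_derivative ?wh' s) (at s within {0..})"
        using wh unfolding filter_solution_def ode_solution_def A
        by (simp add: AE_restrict_space_iff)
      ultimately show "AE s in lebesgue. s \<in> {0..t} \<longrightarrow>
        (\<exists>e'. (e has_vector_derivative e') (at s within {0..t}) \<and>
              2 * (e' \<bullet> e s) \<le> 1 - (2 * a + q) * (e s \<bullet> e s))"
      proof eventually_elim
        case (elim s)
        show ?case
        proof (intro impI exI conjI)
          assume s: "s \<in> {0..t}"
          have "(e has_vector_derivative ?w' s - ?wh' s) (at s within {0..})"
            unfolding e_def using elim s by (intro has_vector_derivative_diff) auto
          then show "(e has_vector_derivative ?w' s - ?wh' s) (at s within {0..t})"
            by (rule has_vector_derivative_within_subset) auto
          have split: "?w' s - ?wh' s = B_mat N1 N2 Lx Ly (w s) *v e s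
              + B1_mat N1 N2 Lx Ly (wh s) *v e s + A *v e s + D *v f s
              - (P s (wh s) ** adj H) *v (H *v e s + F *v \<eta> s)"
            unfolding B1_mat_mult[OF card N1(1) N2(1)] e_def
            by (simp add: B_mat_diff matrix_vector_mult_diff_rdistrib
                matrix_vector_mult_diff_distrib algebra_simps)
          show "2 * ((?w' s - ?wh' s) \<bullet> e s) \<le> 1 - (2 * a + q) * (e s \<bullet> e s)"
            unfolding split
          proof (rule error_energy_bound)
            show "hermitian (P s (wh s))" "pos_def (Q s)" "pos_def (R s)"
              using P Q R s by auto
            show "(matrix_inv (Q s) *v f s) \<bullet> f s + (matrix_inv (R s) *v \<eta> s) \<bullet> \<eta> s \<le> 1"
              using noise[of s] s by (simp add: Re_cinner)
            show "(B_mat N1 N2 Lx Ly (w s) *v e s) \<bullet> e s = 0"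
              using real s by (intro B_mat_inner_self[OF card N1(1) N2(1)]) simp
            show "(A *v e s) \<bullet> e s \<le> - a * (e s \<bullet> e s)" by (rule A_le)
          qed (use ineq[OF dE] s in \<open>simp add: wh_def d\<close>)
        qed
      qed
    qed (use \<open>t > 0\<close> in simp)
  qed simp
  moreover have "e 0 \<bullet> e 0 \<le> max_eigval S"
  proof -
    have "e 0 = w0"
      using w wh by (simp add: e_def state_solution_def filter_solution_def ode_solution_def)
    then show ?thesis using norm_le_max_eigval[OF S] init by (simp add: Re_cinner)
  qed
  then have "(e 0 \<bullet> e 0 - 1 / (2 * a + q)) * exp (- (2 * a + q) * t)
      \<le> (max_eigval S - 1 / (2 * a + q)) * exp (- (2 * a + q) * t)"
    by (intro mult_right_mono) auto
  ultimately have "e t \<bullet> e t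
      \<le> 1 / (2 * a + q) + (max_eigval S - 1 / (2 * a + q)) * exp (- (2 * a + q) * t)"
    by linarith
  then show "ereal (Re (cinner (\<omega> d t - \<omega>hat d t) (\<omega> d t - \<omega>hat d t)))
      \<le> ereal (1 / (2 * \<bar>max_eigval A\<bar> + q) + (max_eigval S - 1 / (2 * \<bar>max_eigval A\<bar> + q))
                 * exp (- (2 * \<bar>max_eigval A\<bar> + q) * t))"
    unfolding Re_cinner e_def w_def wh_def a_def by simp
qed

end
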